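(* Let $c>0$, let $\mathbb{P}\subset\mathbb{R}^3$ be a plane, and let $L'\subset\mathbb{P}$ be a piecewise smooth curve (the source curve). Let $\tau$ be a bounded intensity function with $\tau(x)\geq\tau_0>0$ for a constant $\tau_0$, let $\lambda(t)=\delta(t)$ (the Dirac delta distribution) be the signal function, and let $u(x,t)$ be the (causal) solution to the wave equation $$c^{-2}\partial_{tt}u(x,t)-\triangle u(x,t)=\lambda(t)\tau(x)\delta_{L'}(x),\qquad x\in\mathbb{R}^3,\ t\in\mathbb{R}.$$ Assume that $\Omega'\subset\mathbb{P}$ is an open disc of radius $R$ with $L'\subset\Omega'$, with boundary circle $\partial\Omega'$, and that the sampling region $D'\subset\Omega'$ satisfies $L'\subset D'$ and $D'\cap\partial\Omega'=\varnothing$. For $z\in D'$ define the indicator function $$I'(z)=\int_{\mathbb{R}}\int_{\partial\Omega'}u(x,t)\,\big(G(x,t;z)\ast\lambda(t)\big)\,{\rm d}s(x)\,{\rm d}t .$$ Then $$I'(z)=+\infty\ \text{ for } z\in L',\qquad I'(z)<+\infty\ \text{ for } z\in D'\setminus L'.$$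
   Context: For a curve $L'$, $\delta_{L'}(x)=\int_{L'}\delta(x-y)\,{\rm d}s(y)$, with ${\rm d}s(y)$ arc length on $L'$; the curve has finite length. The Green's function of the d'Alembert operator $c^{-2}\partial_{tt}-\triangle$ in $\mathbb{R}^3$ is $G(x,t;s)=\dfrac{\delta(t-c^{-1}|x-s|)}{4\pi|x-s|}$, and $G(x,t;s)\ast\lambda(t)=\dfrac{\lambda(t-c^{-1}|x-s|)}{4\pi|x-s|}$ denotes convolution in time. The signal is causal (the source vanishes for $t<0$), and the solution of the wave equation is $u(x,t)=\int_{L'}\tau(y)\,G(x,t;y)\ast\lambda(t)\,{\rm d}s(y)$. Here ${\rm d}s(x)$ is arc length on $\partial\Omega'$. Conventions for the delta distributions, since $\lambda=\delta$: the time integral is performed by the rule $\int_{\mathbb{R}}\delta(t-\alpha)\delta(t-\beta)\,{\rm d}t=\delta(\alpha-\beta)$ and the integration over $L'$ is taken outermost, so that $$I'(z)=\int_{L'}\tau(y)\int_{\partial\Omega'}\frac{\delta\left(c^{-1}|x-y|-c^{-1}|x-z|\right)}{16\pi^2|x-y||x-z|}\,{\rm d}s(x)\,{\rm d}s(y).$$ For a continuous function $f$ and a smooth function $h$ on the circle $\partial\Omega'$ having only finitely many zeros $p_i$, all simple, $\int_{\partial\Omega'}f\,\delta(h)\,{\rm d}s=\sum_i f(p_i)/|h'(p_i)|$, where $h'$ is the derivative with respect to arc length (this defines the inner integral for all $y\neq z$). *)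

theory Defs
  imports "HOL-Analysis.Analysis"
begin

section \<open>Delta pulses in time\<close>

text \<open>\<open>Pulse w a\<close> stands for the distribution \<open>w \<delta>(t - a)\<close> in the time variable.\<close>

datatype pulse = Pulse (weight: real) (instant: real)

definition pulse_apply :: "pulse \<Rightarrow> (real \<Rightarrow> real) \<Rightarrow> real" where
  "pulse_apply p f = weight p * f (instant p)"

definition pulse_scale :: "real \<Rightarrow> pulse \<Rightarrow> pulse" where
  "pulse_scale k p = Pulse (k * weight p) (instant p)"

definition pulse_conv :: "pulse \<Rightarrow> pulse \<Rightarrow> pulse" where
  "pulse_conv p q = Pulse (weight p * weight q) (instant p + instant q)"

abbreviation delta_pulse :: pulse where
  "delta_pulse \<equiv> Pulse 1 0"

text \<open>The Green's function \<open>G(x,t;s) = \<delta>(t - |x - s| / c) / (4 \<pi> |x - s|)\<close> of the d'Alembert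
  operator, as a pulse in \<open>t\<close>. At \<open>x = s\<close> the weight is \<open>0\<close> by the convention on division.\<close>

definition green :: "real \<Rightarrow> real^3 \<Rightarrow> real^3 \<Rightarrow> pulse" where
  "green c x s = Pulse (1 / (4 * pi * dist x s)) (dist x s / c)"


section \<open>Piecewise smooth curves and arc length\<close>

text \<open>Piecewise smooth means regular: the derivative does not vanish except at finitely many
  parameters. The derivative may be unbounded at break points, so finite length is required.\<close>

definition piecewise_smooth_curve :: "(real \<Rightarrow> real^3) \<Rightarrow> bool" where
  "piecewise_smooth_curve \<gamma> \<longleftrightarrow>
     path \<gamma> \<and>
     (\<exists>S. finite S \<and> \<gamma> C1_differentiable_on ({0..1} - S) \<and>
          (\<forall>t\<in>{0..1} - S. vector_derivative \<gamma> (at t) \<noteq> 0)) \<and>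
     (\<lambda>t. norm (vector_derivative \<gamma> (at t))) integrable_on {0..1}"

definition arc_integral :: "(real \<Rightarrow> real^3) \<Rightarrow> (real^3 \<Rightarrow> real) \<Rightarrow> real" where
  "arc_integral \<gamma> f =
     (\<integral>t. f (\<gamma> t) * norm (vector_derivative \<gamma> (at t)) \<partial>lebesgue_on {0..1})"

definition arc_nn_integral :: "(real \<Rightarrow> real^3) \<Rightarrow> (real^3 \<Rightarrow> ennreal) \<Rightarrow> ennreal" where
  "arc_nn_integral \<gamma> f =
     (\<integral>\<^sup>+t. f (\<gamma> t) * ennreal (norm (vector_derivative \<gamma> (at t))) \<partial>lebesgue_on {0..1})"


section \<open>The wave equation in the sense of distributions\<close>

definition dderiv :: "'a::real_normed_vector \<Rightarrow> ('a \<Rightarrow> real) \<Rightarrow> 'a \<Rightarrow> real" where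
  "dderiv v f x = frechet_derivative f (at x) v"

definition smooth :: "('a::real_normed_vector \<Rightarrow> real) \<Rightarrow> bool" where
  "smooth f \<longleftrightarrow> (\<forall>vs x. foldr dderiv vs f differentiable at x)"

definition test_function :: "((real^3) \<times> real \<Rightarrow> real) \<Rightarrow> bool" where
  "test_function \<phi> \<longleftrightarrow> smooth \<phi> \<and> compact (closure {p. \<phi> p \<noteq> 0})"

definition dAlembert :: "real \<Rightarrow> ((real^3) \<times> real \<Rightarrow> real) \<Rightarrow> (real^3) \<times> real \<Rightarrow> real" where
  "dAlembert c \<phi> p = dderiv (0, 1) (dderiv (0, 1) \<phi>) p / c\<^sup>2
     - (\<Sum>b\<in>Basis. dderiv (b, 0) (dderiv (b, 0) \<phi>) p)"

text \<open>A field \<open>u(x,t)\<close> radiated by the curve is given by its contributions \<open>u x y\<close> from the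
  points \<open>y\<close> of the curve, each a pulse in \<open>t\<close>: as a distribution on \<open>\<real>\<^sup>3 \<times> \<real>\<close>, \<open>u(x,\<cdot>)\<close> is the
  integral of \<open>u x y\<close> over \<open>y\<close> with respect to arc length.\<close>

type_synonym field = "real^3 \<Rightarrow> real^3 \<Rightarrow> pulse"

definition field_distribution ::
    "(real \<Rightarrow> real^3) \<Rightarrow> field \<Rightarrow> ((real^3) \<times> real \<Rightarrow> real) \<Rightarrow> real" where
  "field_distribution \<gamma> u \<phi> =
     arc_integral \<gamma> (\<lambda>y. \<integral>x. pulse_apply (u x y) (\<lambda>t. \<phi> (x, t)) \<partial>lborel)"

text \<open>Weak form of \<open>c\<^sup>-\<^sup>2 \<partial>\<^sub>t\<^sub>t u - \<Delta> u = \<lambda>(t) \<tau>(x) \<delta>\<^sub>L(x)\<close>, where \<open>L\<close> is the curve \<open>\<gamma>\<close>, together with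
  causality: \<open>u\<close> vanishes for \<open>t < 0\<close>. The d'Alembert operator is its own formal adjoint.\<close>

definition causal_wave_solution ::
    "real \<Rightarrow> pulse \<Rightarrow> (real \<Rightarrow> real^3) \<Rightarrow> (real^3 \<Rightarrow> real) \<Rightarrow> field \<Rightarrow> bool" where
  "causal_wave_solution c l \<gamma> \<tau> u \<longleftrightarrow>
     (\<forall>\<phi>. test_function \<phi> \<longrightarrow>
        field_distribution \<gamma> u (dAlembert c \<phi>)
          = arc_integral \<gamma> (\<lambda>y. \<tau> y * pulse_apply l (\<lambda>t. \<phi> (y, t)))) \<and>
     (\<forall>\<phi>. test_function \<phi> \<and> closure {p. \<phi> p \<noteq> 0} \<subseteq> UNIV \<times> {..<0} \<longrightarrow>
        field_distribution \<gamma> u \<phi> = 0)"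

text \<open>The solution \<open>u(x,t) = \<integral>\<^sub>L \<tau>(y) G(x,t;y) * \<lambda>(t) ds(y)\<close>.\<close>

definition retarded_field :: "real \<Rightarrow> pulse \<Rightarrow> (real^3 \<Rightarrow> real) \<Rightarrow> field" where
  "retarded_field c l \<tau> x y = pulse_scale (\<tau> y) (pulse_conv (green c x y) l)"


section \<open>The indicator function\<close>

definition circle_arc :: "real^3 \<Rightarrow> real \<Rightarrow> real^3 \<Rightarrow> real^3 \<Rightarrow> real \<Rightarrow> real^3" where
  "circle_arc a R e1 e2 s = a + (R * cos (s / R)) *\<^sub>R e1 + (R * sin (s / R)) *\<^sub>R e2"

text \<open>\<open>\<integral> f \<delta>(h) ds\<close> over the circle with centre \<open>a\<close> and radius \<open>R\<close> in the plane through \<open>a\<close> with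
  orthonormal directions \<open>e1\<close>, \<open>e2\<close>, for \<open>h\<close> with finitely many zeros on the circle, all simple.
  Since \<open>circle_arc\<close> has unit speed, \<open>deriv\<close> is the derivative with respect to arc length. If there
  are infinitely many zeros, the sum is \<open>0\<close>.\<close>

definition circle_delta_integral ::
    "real^3 \<Rightarrow> real \<Rightarrow> real^3 \<Rightarrow> real^3 \<Rightarrow> (real^3 \<Rightarrow> real) \<Rightarrow> (real^3 \<Rightarrow> real) \<Rightarrow> real" where
  "circle_delta_integral a R e1 e2 f h =
     (\<Sum>s | 0 \<le> s \<and> s < 2 * pi * R \<and> h (circle_arc a R e1 e2 s) = 0.
        f (circle_arc a R e1 e2 s) / \<bar>deriv (\<lambda>s. h (circle_arc a R e1 e2 s)) s\<bar>)"

text \<open>\<open>\<integral>\<integral> u(x,t) (G(x,t;z) * \<lambda>(t)) ds(x) dt\<close>, with the integration over the curve taken outermost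
  and the time integral of a product of pulses evaluated by
  \<open>\<integral> v \<delta>(t - \<alpha>) w \<delta>(t - \<beta>) dt = v w \<delta>(\<alpha> - \<beta>)\<close>. For \<open>y = z\<close>, where all of the
  circle consists of zeros, the inner integral is \<open>0\<close> here; this concerns a set of arc length \<open>0\<close>.\<close>

definition indicator_function ::
    "real \<Rightarrow> pulse \<Rightarrow> (real \<Rightarrow> real^3) \<Rightarrow> real^3 \<Rightarrow> real \<Rightarrow> real^3 \<Rightarrow> real^3 \<Rightarrow> field \<Rightarrow> real^3 \<Rightarrow> ennreal"
  where
  "indicator_function c l \<gamma> a R e1 e2 u z =
     arc_nn_integral \<gamma> (\<lambda>y. ennreal (circle_delta_integral a R e1 e2
       (\<lambda>x. weight (u x y) * weight (pulse_conv (green c x z) l))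
       (\<lambda>x. instant (u x y) - instant (pulse_conv (green c x z) l))))"


section \<open>The retarded field solves the wave equation\<close>

lemma distr_norm_lborel3:
  "distr (lborel::(real^3) measure) borel norm = density lborel (\<lambda>r. ennreal (4 * pi * r\<^sup>2 * indicator {0..} r))" (is "?M = ?N")
proof (rule measure_eqI_generator_eq[where E = "range atMost" and \<Omega> = UNIV and A = "\<lambda>n::nat. {..real n}"])
  show "Int_stable (range atMost :: real set set)" by (auto simp: Int_stable_def)
  show "sets ?M = sigma_sets UNIV (range atMost)" "sets ?N = sigma_sets UNIV (range atMost)"
    by (simp_all add: borel_eq_atMost)
  have M: "emeasure ?M {..a} = (if 0 \<le> a then ennreal (4/3 * pi * a^3) else 0)" for a :: real
  proof -
    have "emeasure ?M {..a} = emeasure lborel (norm -` {..a} :: (real^3) set)"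
      by (subst emeasure_distr) auto
    also have "(norm -` {..a} :: (real^3) set) = cball 0 a" by (auto simp: dist_norm)
    also have "emeasure lborel \<dots> = (if 0 \<le> a then ennreal (4/3 * pi * a^3) else 0)"
      using emeasure_cball[of a "0::real^3"] by (auto simp: unit_ball_vol_3)
    finally show ?thesis .
  qed
  have N: "emeasure ?N {..a} = (if 0 \<le> a then ennreal (4/3 * pi * a^3) else 0)" for a :: real
  proof -
    have "emeasure ?N {..a} = (\<integral>\<^sup>+r. ennreal (4 * pi * r\<^sup>2) * indicator {0..a} r \<partial>lborel)"
      by (subst emeasure_density) (auto intro!: nn_integral_cong split: split_indicator)
    also have "\<dots> = (if 0 \<le> a then ennreal (4/3 * pi * a^3) else 0)"
    proof (cases "0 \<le> a")
      case True
      have "(\<integral>\<^sup>+r. ennreal (4 * pi * r\<^sup>2) * indicator {0..a} r \<partial>lborel) = 4/3 * pi * a^3 - 4/3*pi*0^3"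
        using True by (intro nn_integral_FTC_Icc) (auto intro!: derivative_eq_intros simp: power2_eq_square)
      with True show ?thesis by simp
    qed auto
    finally show ?thesis .
  qed
  show "emeasure ?M X = emeasure ?N X" if "X \<in> range atMost" for X using that M N by auto
  show "emeasure ?M {..real i} \<noteq> \<infinity>" for i unfolding M by auto
  show "(\<Union>i. {..real i}) = UNIV" by (auto simp: real_arch_simple)
qed auto

lemma nn_integral_radial3:
  assumes "f \<in> borel_measurable borel" "\<And>r. f r \<ge> 0"
  shows "(\<integral>\<^sup>+x. ennreal (f (norm (x::real^3))) \<partial>lborel) = (\<integral>\<^sup>+r. ennreal (4 * pi * r\<^sup>2 * f r) * indicator {0..} r \<partial>lborel)"
proof -
  have "(\<integral>\<^sup>+x. ennreal (f (norm (x::real^3))) \<partial>lborel) = (\<integral>\<^sup>+r. ennreal (f r) \<partial>distr (lborel::(real^3) measure) borel norm)"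
    using assms by (subst nn_integral_distr) auto
  also have "\<dots> = (\<integral>\<^sup>+r. ennreal (4 * pi * r\<^sup>2 * f r) * indicator {0..} r \<partial>lborel)"
    using assms unfolding distr_norm_lborel3
    by (subst nn_integral_density) (auto intro!: nn_integral_cong split: split_indicator simp: ennreal_mult' [symmetric])
  finally show ?thesis .
qed

lemma integrable_inverse_square3:
  "integrable lborel (\<lambda>x::real^3. indicator (cball 0 M) x / (norm x)\<^sup>2)"
proof (rule integrableI_bounded)
  have "(\<integral>\<^sup>+x. ennreal (norm (indicator (cball 0 M) x / (norm (x::real^3))\<^sup>2)) \<partial>lborel)
      = (\<integral>\<^sup>+x. ennreal ((\<lambda>r. indicator {..M} r / r\<^sup>2) (norm (x::real^3))) \<partial>lborel)"
    by (auto intro!: nn_integral_cong split: split_indicator simp: dist_norm)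
  also have "\<dots> = (\<integral>\<^sup>+r. ennreal (4 * pi * r\<^sup>2 * (indicator {..M} r / r\<^sup>2)) * indicator {0..} r \<partial>lborel)"
    by (rule nn_integral_radial3) auto
  also have "\<dots> \<le> (\<integral>\<^sup>+r. ennreal (4 * pi) * indicator {0..M} r \<partial>lborel)"
    by (intro nn_integral_mono) (auto split: split_indicator)
  also have "\<dots> < \<infinity>" by (auto simp: nn_integral_cmult emeasure_lborel_Icc_eq ennreal_mult_less_top)
  finally show "(\<integral>\<^sup>+x. ennreal (norm (indicator (cball 0 M) x / (norm (x::real^3))\<^sup>2)) \<partial>lborel) < \<infinity>" .
  have [measurable]: "cball (0::real^3) M \<in> sets borel" by simp
  show "(\<lambda>x::real^3. indicator (cball 0 M) x / (norm x)\<^sup>2) \<in> borel_measurable lborel" by measurable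
qed

lemma cubic_quotient:
  assumes "(q has_real_derivative q') (at r)" "q r \<noteq> 0"
  shows "((\<lambda>r. K * r^3 / q r^3) has_real_derivative
    (K * (3 * r\<^sup>2) * q r^3 - K * r^3 * (3 * q r^2 * q')) / (q r^3 * q r^3)) (at r)"
  using assms by (auto intro!: derivative_eq_intros assms(1))

lemma integral_kernel3:
  assumes "M > 0" "\<epsilon> > 0"
  shows "has_bochner_integral lborel (\<lambda>x::real^3. indicator (cball 0 M) x * (3 * \<epsilon>\<^sup>2 / sqrt ((norm x)\<^sup>2 + \<epsilon>\<^sup>2)^5))
     (4 * pi * M^3 / sqrt (M\<^sup>2 + \<epsilon>\<^sup>2)^3)"
proof (rule has_bochner_integral_nn_integral)
  have pos: "r\<^sup>2 + \<epsilon>\<^sup>2 > 0" for r using assms by (simp add: add_nonneg_pos)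
  have "(\<integral>\<^sup>+x. ennreal (indicator (cball 0 M) x * (3 * \<epsilon>\<^sup>2 / sqrt ((norm (x::real^3))\<^sup>2 + \<epsilon>\<^sup>2)^5)) \<partial>lborel)
      = (\<integral>\<^sup>+x. ennreal ((\<lambda>r. indicator {..M} r * (3 * \<epsilon>\<^sup>2 / sqrt (r\<^sup>2 + \<epsilon>\<^sup>2)^5)) (norm (x::real^3))) \<partial>lborel)"
    by (auto intro!: nn_integral_cong split: split_indicator simp: dist_norm)
  also have "\<dots> = (\<integral>\<^sup>+r. ennreal (4 * pi * r\<^sup>2 * (indicator {..M} r * (3 * \<epsilon>\<^sup>2 / sqrt (r\<^sup>2 + \<epsilon>\<^sup>2)^5))) * indicator {0..} r \<partial>lborel)"
    by (rule nn_integral_radial3) auto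
  also have "\<dots> = (\<integral>\<^sup>+r. ennreal (4 * pi * r\<^sup>2 * (3 * \<epsilon>\<^sup>2 / sqrt (r\<^sup>2 + \<epsilon>\<^sup>2)^5)) * indicator {0..M} r \<partial>lborel)"
    by (intro nn_integral_cong) (auto split: split_indicator)
  also have "\<dots> = 4 * pi * M^3 / sqrt (M\<^sup>2 + \<epsilon>\<^sup>2)^3 - 4 * pi * 0^3 / sqrt (0\<^sup>2 + \<epsilon>\<^sup>2)^3"
  proof (rule nn_integral_FTC_Icc)
    fix r :: real
    have s: "sqrt (r\<^sup>2 + \<epsilon>\<^sup>2) > 0" using pos by simp
    have "((\<lambda>r. 4 * pi * r^3 / sqrt (r\<^sup>2 + \<epsilon>\<^sup>2)^3) has_real_derivative
      (4 * pi * (3 * r\<^sup>2) * sqrt (r\<^sup>2 + \<epsilon>\<^sup>2)^3 - 4 * pi * r^3 * (3 * sqrt (r\<^sup>2 + \<epsilon>\<^sup>2)^2 * (r / sqrt (r\<^sup>2 + \<epsilon>\<^sup>2)))) / (sqrt (r\<^sup>2 + \<epsilon>\<^sup>2)^3 * sqrt (r\<^sup>2 + \<epsilon>\<^sup>2)^3)) (at r)"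
    proof -
      have q: "((\<lambda>r. sqrt (r\<^sup>2 + \<epsilon>\<^sup>2)) has_real_derivative r / sqrt (r\<^sup>2 + \<epsilon>\<^sup>2)) (at r)"
        using pos[of r] s by (auto intro!: derivative_eq_intros simp: divide_simps)
      show ?thesis
        by (rule cubic_quotient[OF q less_imp_neq[OF s, symmetric]])
    qed
    moreover have "(4 * pi * (3 * r\<^sup>2) * sqrt (r\<^sup>2 + \<epsilon>\<^sup>2)^3 - 4 * pi * r^3 * (3 * sqrt (r\<^sup>2 + \<epsilon>\<^sup>2)^2 * (r / sqrt (r\<^sup>2 + \<epsilon>\<^sup>2)))) / (sqrt (r\<^sup>2 + \<epsilon>\<^sup>2)^3 * sqrt (r\<^sup>2 + \<epsilon>\<^sup>2)^3)
       = 4 * pi * r\<^sup>2 * (3 * \<epsilon>\<^sup>2 / sqrt (r\<^sup>2 + \<epsilon>\<^sup>2)^5)" 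
    proof -
      define q where "q = sqrt (r\<^sup>2 + \<epsilon>\<^sup>2)"
      have q: "q > 0" "\<epsilon>\<^sup>2 = q\<^sup>2 - r\<^sup>2" using s pos[of r] by (auto simp: q_def)
      show ?thesis unfolding q_def[symmetric] using q(1) unfolding q(2)
        by (simp add: field_simps power_numeral_reduce)
    qed
    ultimately show "((\<lambda>r. 4 * pi * r^3 / sqrt (r\<^sup>2 + \<epsilon>\<^sup>2)^3) has_real_derivative 4 * pi * r\<^sup>2 * (3 * \<epsilon>\<^sup>2 / sqrt (r\<^sup>2 + \<epsilon>\<^sup>2)^5)) (at r)"
      by simp
  qed (use assms in auto)
  finally show "(\<integral>\<^sup>+x. ennreal (indicator (cball 0 M) x * (3 * \<epsilon>\<^sup>2 / sqrt ((norm (x::real^3))\<^sup>2 + \<epsilon>\<^sup>2)^5)) \<partial>lborel) = ennreal (4 * pi * M^3 / sqrt (M\<^sup>2 + \<epsilon>\<^sup>2)^3)"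
    by simp
  have [measurable]: "cball (0::real^3) M \<in> sets borel" by simp
  show "(\<lambda>x::real^3. indicator (cball 0 M) x * (3 * \<epsilon>\<^sup>2 / sqrt ((norm x)\<^sup>2 + \<epsilon>\<^sup>2)^5)) \<in> borel_measurable lborel"
    by measurable
qed (use assms in auto)

lemma integral_dderiv_zero:
  fixes F :: "'a::euclidean_space \<Rightarrow> real"
  assumes d: "\<And>x. (F has_derivative F' x) (at x)"
    and cont: "continuous_on UNIV (\<lambda>x. F' x e)"
    and supp: "\<And>x. norm x > M \<Longrightarrow> F x = 0"
  shows "has_bochner_integral lborel (\<lambda>x. F' x e) 0"
proof -
  have cF: "continuous_on UNIV F"
    using d by (meson continuous_at_imp_continuous_on has_derivative_continuous)
  have [measurable]: "F \<in> borel_measurable borel" using cF by (rule borel_measurable_continuous_onI)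
  have intF: "integrable lborel F"
  proof -
    have "integrable lborel (\<lambda>x. indicator (cball 0 M) x *\<^sub>R F x)"
      by (intro borel_integrable_compact continuous_on_subset[OF cF]) auto
    also have "(\<lambda>x. indicator (cball 0 M) x *\<^sub>R F x) = F"
      by (rule ext, rename_tac x, case_tac "norm x > M") (simp_all add: supp)
    finally show ?thesis .
  qed
  have "compact ((\<lambda>x. F' x e) ` cball 0 (M + norm e))"
    by (intro compact_continuous_image continuous_on_subset[OF cont]) auto
  then have "bounded ((\<lambda>x. F' x e) ` cball 0 (M + norm e))" by (rule compact_imp_bounded)
  then obtain B where B0': "\<forall>x\<in>cball 0 (M + norm e). \<bar>F' x e\<bar> \<le> B" unfolding bounded_iff by auto
  note B0 = bspec[OF B0']
  have z: "F' x e = 0" if "norm x > M" for x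
  proof -
    have "(F has_derivative (\<lambda>_. 0)) (at x)"
      by (rule has_derivative_transform_within_open[where f = "\<lambda>_. 0" and s = "- cball 0 M"])
        (use that supp in \<open>auto simp: dist_norm\<close>)
    from has_derivative_unique[OF d this] show ?thesis by simp
  qed
  have B: "\<bar>F' x e\<bar> \<le> max B 0" for x
    using B0[of x] z[of x] norm_ge_zero[of e] by (cases "norm x > M") (auto simp: dist_norm)
  define h where "h = (\<lambda>n. 1 / real (Suc n))"
  have h: "h n > 0" "h n \<le> 1" for n by (auto simp: h_def)
  have hl: "h \<longlonglongrightarrow> 0" unfolding h_def using LIMSEQ_inverse_real_of_nat by (simp add: field_simps)
  have line: "((\<lambda>t. F (x + t *\<^sub>R e)) has_real_derivative F' (x + t *\<^sub>R e) e) (at t)" for x t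
  proof -
    have "((\<lambda>t. F (x + t *\<^sub>R e)) has_derivative (\<lambda>s. F' (x + t *\<^sub>R e) (s *\<^sub>R e))) (at t)"
      by (rule has_derivative_compose[of "\<lambda>t. x + t *\<^sub>R e", OF _ d]) (auto intro!: derivative_eq_intros)
    moreover have "F' (x + t *\<^sub>R e) (s *\<^sub>R e) = F' (x + t *\<^sub>R e) e * s" for s
      using linear_scale[OF has_derivative_linear[OF d]] by simp
    ultimately show ?thesis by (simp only: has_field_derivative_def)
  qed
  let ?q = "\<lambda>n x. (F (x + h n *\<^sub>R e) - F x) / h n"
  have "(\<lambda>n. \<integral>x. ?q n x \<partial>lborel) \<longlonglongrightarrow> (\<integral>x. F' x e \<partial>lborel)"
  proof (rule integral_dominated_convergence[where w = "\<lambda>x. indicator (cball 0 (M + norm e)) x * max B 0"])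
    show "(\<lambda>x. F' x e) \<in> borel_measurable lborel" using cont by (simp add: borel_measurable_continuous_onI)
    show "integrable lborel (\<lambda>x::'a. indicator (cball 0 (M + norm e)) x * max B 0)"
      using borel_integrable_compact[of "cball (0::'a) (M + norm e)" "\<lambda>_. max B 0"] by simp
    show "AE x in lborel. (\<lambda>n. ?q n x) \<longlonglongrightarrow> F' x e"
    proof (rule AE_I2)
      fix x
      have "((\<lambda>s. (F (x + s *\<^sub>R e) - F x) / s) \<longlongrightarrow> F' x e) (at 0)"
        using line[of x 0] by (simp add: DERIV_def)
      then show "(\<lambda>n. ?q n x) \<longlonglongrightarrow> F' x e"
        by (rule filterlim_compose) (use h hl in \<open>auto simp: filterlim_at less_imp_neq[symmetric] intro!: always_eventually\<close>)
    qed
    show "AE x in lborel. norm (?q n x) \<le> indicator (cball 0 (M + norm e)) x * max B 0" for n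
    proof (rule AE_I2)
      fix x
      show "norm (?q n x) \<le> indicator (cball 0 (M + norm e)) x * max B 0"
      proof (cases "x \<in> cball 0 (M + norm e)")
        case True
        have "\<exists>t. 0 < t \<and> t < h n \<and> F (x + h n *\<^sub>R e) - F (x + 0 *\<^sub>R e) = (h n - 0) * F' (x + t *\<^sub>R e) e"
          by (rule MVT2) (use h line in auto)
        then obtain t where "F (x + h n *\<^sub>R e) - F x = h n * F' (x + t *\<^sub>R e) e" by auto
        then have "?q n x = F' (x + t *\<^sub>R e) e" using h(1)[of n] by simp
        with True B show ?thesis by simp
      next
        case False
        then have n: "norm x > M + norm e" by (simp add: dist_norm)
        have "norm x \<le> norm (x + h n *\<^sub>R e) + norm (h n *\<^sub>R e)"
          by (metis add_diff_cancel norm_triangle_ineq4)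
        moreover have "norm (h n *\<^sub>R e) \<le> norm e" using h[of n] by (simp add: mult_left_le_one_le)
        ultimately have "norm (x + h n *\<^sub>R e) > M" using n by linarith
        moreover have "norm x > M" using n norm_ge_zero[of e] by linarith
        ultimately show ?thesis using supp by simp
      qed
    qed
  qed auto
  moreover have "(\<integral>x. ?q n x \<partial>lborel) = 0" for n
  proof -
    have I: "integrable lborel (\<lambda>x. F (h n *\<^sub>R e + x))"
      by (subst integrable_distr_eq[of "(+) (h n *\<^sub>R e)" lborel borel F, symmetric]) (auto simp: lborel_distr_plus intF)
    have "(\<integral>x. F (h n *\<^sub>R e + x) \<partial>lborel) = (\<integral>x. F x \<partial>distr lborel borel ((+) (h n *\<^sub>R e)))"
      by (subst integral_distr) auto
    also have "\<dots> = (\<integral>x. F x \<partial>lborel)" by (simp add: lborel_distr_plus)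
    finally show ?thesis using I intF by (simp add: add.commute)
  qed
  ultimately have "(\<lambda>n. 0) \<longlonglongrightarrow> (\<integral>x. F' x e \<partial>lborel)" by (simp only:)
  then have "(\<integral>x. F' x e \<partial>lborel) = 0" by (simp add: LIMSEQ_const_iff)
  moreover have "integrable lborel (\<lambda>x. indicator (cball 0 M) x *\<^sub>R F' x e)"
    by (intro borel_integrable_compact continuous_on_subset[OF cont]) auto
  moreover have "(\<lambda>x. indicator (cball 0 M) x *\<^sub>R F' x e) = (\<lambda>x. F' x e)"
    by (rule ext, rename_tac x, case_tac "norm x > M") (simp_all add: z)
  ultimately show ?thesis by (simp add: has_bochner_integral_iff)
qed

lemma smooth_dderiv: "smooth f \<Longrightarrow> smooth (dderiv v f)"
  unfolding smooth_def
proof (intro allI)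
  fix vs x assume "\<forall>vs x. foldr dderiv vs f differentiable at x"
  then have "foldr dderiv (vs @ [v]) f differentiable at x" by blast
  then show "foldr dderiv vs (dderiv v f) differentiable at x" by simp
qed

lemma smooth_has_derivative: "smooth f \<Longrightarrow> (f has_derivative (\<lambda>v. dderiv v f x)) (at x)"
  unfolding smooth_def dderiv_def
  by (drule spec[of _ "[]"]) (simp add: frechet_derivative_works)

lemma smooth_continuous: "smooth f \<Longrightarrow> continuous_on S f"
  by (meson continuous_at_imp_continuous_on has_derivative_continuous smooth_has_derivative)

lemma linear_dderiv: "smooth f \<Longrightarrow> linear (\<lambda>v. dderiv v f x)"
  using has_derivative_linear smooth_has_derivative by blast

lemma dderiv_line:
  assumes "smooth f"
  shows "((\<lambda>t. f (x + t *\<^sub>R v)) has_real_derivative dderiv v f (x + t *\<^sub>R v)) (at t)"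
proof -
  have "((\<lambda>t. f (x + t *\<^sub>R v)) has_derivative (\<lambda>s. dderiv (s *\<^sub>R v) f (x + t *\<^sub>R v))) (at t)"
    by (rule has_derivative_compose[of "\<lambda>t. x + t *\<^sub>R v", OF _ smooth_has_derivative[OF assms]])
      (auto intro!: derivative_eq_intros)
  moreover have "dderiv (s *\<^sub>R v) f (x + t *\<^sub>R v) = dderiv v f (x + t *\<^sub>R v) * s" for s
    using linear_scale[OF linear_dderiv[OF assms]] by simp
  ultimately show ?thesis by (simp only: has_field_derivative_def)
qed

lemma second_difference:
  assumes "smooth f" "r > 0"
  shows "\<exists>s t. 0 < s \<and> s < r \<and> 0 < t \<and> t < r \<and>
    f (x + r *\<^sub>R v + r *\<^sub>R w) - f (x + r *\<^sub>R v) - f (x + r *\<^sub>R w) + f x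
      = r * r * dderiv w (dderiv v f) (x + s *\<^sub>R v + t *\<^sub>R w)"
proof -
  have "\<exists>s. 0 < s \<and> s < r \<and>
      (f (x + r *\<^sub>R w + r *\<^sub>R v) - f (x + r *\<^sub>R v)) - (f (x + r *\<^sub>R w + 0 *\<^sub>R v) - f (x + 0 *\<^sub>R v)) =
      (r - 0) * (dderiv v f (x + r *\<^sub>R w + s *\<^sub>R v) - dderiv v f (x + s *\<^sub>R v))"
    by (rule MVT2) (use assms in \<open>auto intro!: DERIV_diff dderiv_line\<close>)
  then obtain s where s: "0 < s" "s < r"
    "f (x + r *\<^sub>R v + r *\<^sub>R w) - f (x + r *\<^sub>R v) - f (x + r *\<^sub>R w) + f x =
      r * (dderiv v f (x + s *\<^sub>R v + r *\<^sub>R w) - dderiv v f (x + s *\<^sub>R v))" by (auto simp: algebra_simps)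
  have "\<exists>t. 0 < t \<and> t < r \<and> dderiv v f (x + s *\<^sub>R v + r *\<^sub>R w) - dderiv v f (x + s *\<^sub>R v + 0 *\<^sub>R w) =
      (r - 0) * dderiv w (dderiv v f) (x + s *\<^sub>R v + t *\<^sub>R w)"
    by (rule MVT2) (use assms in \<open>auto intro!: dderiv_line smooth_dderiv\<close>)
  with s show ?thesis by auto
qed

lemma dderiv_commute:
  assumes "smooth f"
  shows "dderiv w (dderiv v f) x = dderiv v (dderiv w f) x"
proof -
  define h where "h = (\<lambda>n. 1 / real (Suc n))"
  have h: "h n > 0" for n by (auto simp: h_def)
  have hl: "h \<longlonglongrightarrow> 0" unfolding h_def using LIMSEQ_inverse_real_of_nat by (simp add: field_simps)
  have lim: "(\<lambda>n. dderiv w (dderiv v f) (x + s n *\<^sub>R v + t n *\<^sub>R w)) \<longlonglongrightarrow> dderiv w (dderiv v f) x"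
    if "\<And>n. 0 < s n" "\<And>n. s n < h n" "\<And>n. 0 < t n" "\<And>n. t n < h n" for s t v w
  proof -
    have "s \<longlonglongrightarrow> 0" "t \<longlonglongrightarrow> 0"
      by (rule tendsto_sandwich[OF _ _ tendsto_const hl]; use that in \<open>auto intro!: always_eventually less_imp_le\<close>)+
    then have "(\<lambda>n. x + s n *\<^sub>R v + t n *\<^sub>R w) \<longlonglongrightarrow> x + 0 *\<^sub>R v + 0 *\<^sub>R w" by (intro tendsto_intros)
    then have "(\<lambda>n. x + s n *\<^sub>R v + t n *\<^sub>R w) \<longlonglongrightarrow> x" by simp
    moreover have "isCont (dderiv w (dderiv v f)) x"
      using has_derivative_continuous[OF smooth_has_derivative[OF smooth_dderiv[OF smooth_dderiv[OF assms]]]] .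
    ultimately show ?thesis by (rule isCont_tendsto_compose[rotated])
  qed
  have seq: "\<exists>s t. \<forall>n. 0 < s n \<and> s n < h n \<and> 0 < t n \<and> t n < h n \<and>
      f (x + h n *\<^sub>R v + h n *\<^sub>R w) - f (x + h n *\<^sub>R v) - f (x + h n *\<^sub>R w) + f x
      = h n * h n * dderiv w (dderiv v f) (x + s n *\<^sub>R v + t n *\<^sub>R w)" for v w
  proof -
    have "\<forall>n. \<exists>p. 0 < fst p \<and> fst p < h n \<and> 0 < snd p \<and> snd p < h n \<and>
      f (x + h n *\<^sub>R v + h n *\<^sub>R w) - f (x + h n *\<^sub>R v) - f (x + h n *\<^sub>R w) + f x
      = h n * h n * dderiv w (dderiv v f) (x + fst p *\<^sub>R v + snd p *\<^sub>R w)"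
      unfolding split_paired_Ex fst_conv snd_conv using second_difference[OF assms h, where x=x and v=v and w=w] by (intro allI)
    from choice[OF this] obtain p where "\<forall>n. 0 < fst (p n) \<and> fst (p n) < h n \<and> 0 < snd (p n) \<and> snd (p n) < h n \<and>
      f (x + h n *\<^sub>R v + h n *\<^sub>R w) - f (x + h n *\<^sub>R v) - f (x + h n *\<^sub>R w) + f x
      = h n * h n * dderiv w (dderiv v f) (x + fst (p n) *\<^sub>R v + snd (p n) *\<^sub>R w)" by (elim exE)
    then show ?thesis by (intro exI[of _ "\<lambda>n. fst (p n)"] exI[of _ "\<lambda>n. snd (p n)"])
  qed
  obtain s t where st0: "\<forall>n. 0 < s n \<and> s n < h n \<and> 0 < t n \<and> t n < h n \<and>
      f (x + h n *\<^sub>R v + h n *\<^sub>R w) - f (x + h n *\<^sub>R v) - f (x + h n *\<^sub>R w) + f x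
      = h n * h n * dderiv w (dderiv v f) (x + s n *\<^sub>R v + t n *\<^sub>R w)" using seq[of v w] by (elim exE)
  note st = st0[rule_format, THEN conjunct1] st0[rule_format, THEN conjunct2, THEN conjunct1]
    st0[rule_format, THEN conjunct2, THEN conjunct2, THEN conjunct1]
    st0[rule_format, THEN conjunct2, THEN conjunct2, THEN conjunct2, THEN conjunct1]
    st0[rule_format, THEN conjunct2, THEN conjunct2, THEN conjunct2, THEN conjunct2]
  obtain s' t' where st'0: "\<forall>n. 0 < s' n \<and> s' n < h n \<and> 0 < t' n \<and> t' n < h n \<and>
      f (x + h n *\<^sub>R w + h n *\<^sub>R v) - f (x + h n *\<^sub>R w) - f (x + h n *\<^sub>R v) + f x
      = h n * h n * dderiv v (dderiv w f) (x + s' n *\<^sub>R w + t' n *\<^sub>R v)" using seq[of w v] by (elim exE)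
  note st' = st'0[rule_format, THEN conjunct1] st'0[rule_format, THEN conjunct2, THEN conjunct1]
    st'0[rule_format, THEN conjunct2, THEN conjunct2, THEN conjunct1]
    st'0[rule_format, THEN conjunct2, THEN conjunct2, THEN conjunct2, THEN conjunct1]
    st'0[rule_format, THEN conjunct2, THEN conjunct2, THEN conjunct2, THEN conjunct2]
  have "dderiv w (dderiv v f) (x + s n *\<^sub>R v + t n *\<^sub>R w) = dderiv v (dderiv w f) (x + s' n *\<^sub>R w + t' n *\<^sub>R v)" for n
  proof -
    have "h n * h n * dderiv w (dderiv v f) (x + s n *\<^sub>R v + t n *\<^sub>R w) = h n * h n * dderiv v (dderiv w f) (x + s' n *\<^sub>R w + t' n *\<^sub>R v)"
      using st(5)[of n] st'(5)[of n] by (simp add: algebra_simps)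
    then show ?thesis using h[of n] by simp
  qed
  then have "(\<lambda>n. dderiv w (dderiv v f) (x + s n *\<^sub>R v + t n *\<^sub>R w)) \<longlonglongrightarrow> dderiv v (dderiv w f) x"
    using lim[OF st'(1-4), of v w] by (simp only:)
  then show ?thesis by (rule LIMSEQ_unique[OF lim[OF st(1-4)]])
qed

lemma dderiv_eq_0:
  assumes "\<And>p. norm p > M \<Longrightarrow> f p = 0" "norm p > M" "smooth f"
  shows "dderiv v f p = 0"
proof -
  have "(f has_derivative (\<lambda>_. 0)) (at p)"
    by (rule has_derivative_transform_within_open[where f = "\<lambda>_. 0" and s = "- cball 0 M"])
      (use assms in \<open>auto simp: dist_norm\<close>)
  from fun_cong[OF has_derivative_unique[OF smooth_has_derivative[OF assms(3)] this], of v] show ?thesis .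
qed

lemma smooth_bounded:
  fixes f :: "'a::euclidean_space \<Rightarrow> real"
  assumes "\<And>p. norm p > M \<Longrightarrow> f p = 0" "smooth f"
  shows "\<exists>B\<ge>0. \<forall>p. \<bar>f p\<bar> \<le> B"
proof -
  have "bounded (f ` cball 0 M)"
    by (intro compact_imp_bounded compact_continuous_image smooth_continuous assms) auto
  then obtain B where B: "\<forall>p\<in>cball 0 M. \<bar>f p\<bar> \<le> B" unfolding bounded_iff by auto
  have "\<bar>f p\<bar> \<le> max B 0" for p
    using B assms(1)[of p] by (cases "norm p > M") (auto simp: dist_norm le_max_iff_disj)
  then show ?thesis by (intro exI[of _ "max B 0"]) auto
qed

lemma dderiv_split:
  fixes f :: "(real^3) \<times> real \<Rightarrow> real"
  assumes "smooth f"
  shows "dderiv (h, k) f p = dderiv (h, 0) f p + k * dderiv (0, 1) f p"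
proof -
  have "dderiv (h, k) f p = dderiv ((h, 0) + k *\<^sub>R (0, 1)) f p" by simp
  also have "\<dots> = dderiv (h, 0) f p + dderiv (k *\<^sub>R (0, 1)) f p"
    by (rule linear_add[OF linear_dderiv[OF assms]])
  also have "dderiv (k *\<^sub>R (0, 1)) f p = k *\<^sub>R dderiv (0, 1) f p"
    by (rule linear_scale[OF linear_dderiv[OF assms]])
  also have "\<dots> = k * dderiv (0, 1) f p" by simp
  finally show ?thesis .
qed

lemma dderiv_split_Basis:
  fixes f :: "(real^3) \<times> real \<Rightarrow> real"
  assumes "smooth f"
  shows "dderiv (h, k) f p = (\<Sum>b\<in>Basis. (h \<bullet> b) * dderiv (b, 0) f p) + k * dderiv (0, 1) f p"
proof -
  have l: "linear (\<lambda>h. dderiv (h, 0) f p)"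
  proof (rule linearI)
    fix x y :: "real^3" and r :: real
    show "dderiv (x + y, 0) f p = dderiv (x, 0) f p + dderiv (y, 0) f p"
      using linear_add[OF linear_dderiv[OF assms, of p], of "(x, 0)" "(y, 0)"] by simp
    show "dderiv (r *\<^sub>R x, 0) f p = r *\<^sub>R dderiv (x, 0) f p"
      using linear_scale[OF linear_dderiv[OF assms, of p], of r "(x, 0)"] by simp
  qed
  have "dderiv (h, 0) f p = dderiv (\<Sum>b\<in>Basis. (h \<bullet> b) *\<^sub>R b, 0) f p" by (simp add: euclidean_representation)
  also have "\<dots> = (\<Sum>b\<in>Basis. (h \<bullet> b) * dderiv (b, 0) f p)"
    using linear_sum[OF l, of "\<lambda>b. (h \<bullet> b) *\<^sub>R b" Basis] linear_scale[OF l] by simp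
  finally show ?thesis by (subst dderiv_split[OF assms]) (simp only:)
qed

text \<open>With \<open>\<rho> = sqrt (|x|\<^sup>2 + \<epsilon>\<^sup>2)\<close> in place of \<open>|x|\<close>, the integrand below is the divergence of
  \<open>- \<nabla>f / \<rho> + x \<partial>\<^sub>t f / (c \<rho>\<^sup>2) - x f / \<rho>\<^sup>3\<close>, taken at \<open>(x + y, \<rho> / c)\<close>. The limit \<open>\<epsilon> \<rightarrow> 0\<close> gives
  \<open>retarded_potential\<close>.\<close>

lemma wave_divergence_zero:
  fixes f :: "(real^3) \<times> real \<Rightarrow> real" and y :: "real^3"
  assumes f: "smooth f" and supp: "\<And>p. norm p > M \<Longrightarrow> f p = 0"
    and c: "c > 0" and \<epsilon>: "\<epsilon> > 0"
  defines "\<rho> \<equiv> \<lambda>x::real^3. sqrt ((norm x)\<^sup>2 + \<epsilon>\<^sup>2)"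
  defines "ev \<equiv> \<lambda>g x. (g :: (real^3) \<times> real \<Rightarrow> real) (x + y, \<rho> x / c)"
  shows "has_bochner_integral lborel (\<lambda>x. ev (dAlembert c f) x / \<rho> x
     - \<epsilon>\<^sup>2 * ev (dderiv (0,1) (dderiv (0,1) f)) x / (c\<^sup>2 * \<rho> x^3)
     + 3 * \<epsilon>\<^sup>2 * ev (dderiv (0,1) f) x / (c * \<rho> x^4) - 3 * \<epsilon>\<^sup>2 * ev f x / \<rho> x^5) 0"
proof -
  have pos: "(norm x)\<^sup>2 + \<epsilon>\<^sup>2 > 0" for x :: "real^3" using \<epsilon> by (simp add: add_nonneg_pos)
  have \<rho>: "\<rho> x > 0" "(\<rho> x)\<^sup>2 = (norm x)\<^sup>2 + \<epsilon>\<^sup>2" for x using pos[of x] by (simp_all add: \<rho>_def)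
  have d\<rho>: "(\<rho> has_derivative (\<lambda>h. (x \<bullet> h) / \<rho> x)) (at x)" for x
    using pos[of x] unfolding \<rho>_def power2_norm_eq_inner
    by (auto intro!: derivative_eq_intros simp: inner_commute divide_simps)
  have dev: "(ev g has_derivative (\<lambda>h. dderiv (h, 0) g (x + y, \<rho> x / c) + (x \<bullet> h) / (\<rho> x * c) * dderiv (0, 1) g (x + y, \<rho> x / c))) (at x)"
    if g: "smooth g" for g x
  proof -
    have "((\<lambda>x. (x + y, \<rho> x / c)) has_derivative (\<lambda>h. (h, (x \<bullet> h) / (\<rho> x * c)))) (at x)"
      using c \<rho>(1)[of x] by (auto intro!: derivative_eq_intros d\<rho> simp: divide_simps)
    from has_derivative_compose[OF this smooth_has_derivative[OF g]]
    show ?thesis unfolding ev_def dderiv_split[OF g, symmetric] .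
  qed
  have cont: "continuous_on UNIV (ev g)" if "smooth g" for g
    using dev[OF that] by (meson continuous_at_imp_continuous_on has_derivative_continuous)
  have cont\<rho>: "continuous_on UNIV \<rho>" unfolding \<rho>_def by (intro continuous_intros)
  let ?t = "dderiv (0, 1) :: _ \<Rightarrow> (real^3) \<times> real \<Rightarrow> real"
  let ?d = "\<lambda>b::real^3. dderiv (b, 0::real)"
  have sm: "smooth (?t f)" "smooth (?t (?t f))" "smooth (?d b f)" "smooth (?d b (?d b f))" "smooth (?t (?d b f))" "smooth (?d b (?t f))" for b
    using f by (simp_all add: smooth_dderiv)
  have ev0: "ev g x = 0" if g: "\<And>p. norm p > M \<Longrightarrow> g p = 0" and x: "norm x > M + norm y" for g x
  proof -
    have "norm x \<le> norm (x + y) + norm y" using norm_triangle_ineq4[of "x + y" y] by simp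
    moreover have "norm (x + y) \<le> norm (x + y, \<rho> x / c)" using norm_fst_le[of "x + y" "\<rho> x / c"] by simp
    ultimately show ?thesis using g x unfolding ev_def by simp
  qed
  define F where "F = (\<lambda>b x. - ev (?d b f) x / \<rho> x + (x \<bullet> b) * ev (?t f) x / (c * (\<rho> x)^2) - (x \<bullet> b) * ev f x / (\<rho> x)^3)"
  define E where "E = (\<lambda>h g x. dderiv (h, 0) g (x + y, \<rho> x / c) + (x \<bullet> h) / (\<rho> x * c) * ev (?t g) x)"
  define F' where "F' = (\<lambda>b x h. - E h (?d b f) x / \<rho> x + ev (?d b f) x * ((x \<bullet> h) / \<rho> x) / (\<rho> x)^2
      + ((h \<bullet> b) * ev (?t f) x + (x \<bullet> b) * E h (?t f) x) / (c * (\<rho> x)^2)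
      - 2 * (x \<bullet> b) * ev (?t f) x * ((x \<bullet> h) / \<rho> x) / (c * (\<rho> x)^3)
      - ((h \<bullet> b) * ev f x + (x \<bullet> b) * E h f x) / (\<rho> x)^3
      + 3 * (x \<bullet> b) * ev f x * ((x \<bullet> h) / \<rho> x) / (\<rho> x)^4)"
  have dE: "(ev g has_derivative (\<lambda>h. E h g x)) (at x)" if "smooth g" for g x
    using dev[OF that, of x] unfolding E_def ev_def .
  have dF: "(F b has_derivative F' b x) (at x)" for b x
  proof -
    have r: "\<rho> x \<noteq> 0" "c \<noteq> 0" using \<rho>(1)[of x] c by auto
    have 1: "((\<lambda>x. - ev (?d b f) x / \<rho> x) has_derivative (\<lambda>h. - E h (?d b f) x / \<rho> x + ev (?d b f) x * ((x \<bullet> h) / \<rho> x) / (\<rho> x)^2)) (at x)"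
      using r by (auto intro!: derivative_eq_intros dE[OF sm(3)] d\<rho> simp: field_simps power2_eq_square)
    have 2: "((\<lambda>x. (x \<bullet> b) * ev (?t f) x / (c * (\<rho> x)^2)) has_derivative (\<lambda>h. ((h \<bullet> b) * ev (?t f) x + (x \<bullet> b) * E h (?t f) x) / (c * (\<rho> x)^2)
      - 2 * (x \<bullet> b) * ev (?t f) x * ((x \<bullet> h) / \<rho> x) / (c * (\<rho> x)^3))) (at x)"
      using r by (auto intro!: derivative_eq_intros dE[OF sm(1)] d\<rho> simp: field_simps power_numeral_reduce)
    have 3: "((\<lambda>x. (x \<bullet> b) * ev f x / (\<rho> x)^3) has_derivative (\<lambda>h. ((h \<bullet> b) * ev f x + (x \<bullet> b) * E h f x) / (\<rho> x)^3
      - 3 * (x \<bullet> b) * ev f x * ((x \<bullet> h) / \<rho> x) / (\<rho> x)^4)) (at x)"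
      using r by (auto intro!: derivative_eq_intros dE[OF f] d\<rho> simp: field_simps power_numeral_reduce)
    show ?thesis unfolding F_def F'_def
      using has_derivative_diff[OF has_derivative_add[OF 1 2] 3] by (simp add: algebra_simps)
  qed
  have contE: "continuous_on UNIV (E h g)" if "smooth g" for h g
  proof -
    have "E h g = (\<lambda>x. ev (dderiv (h, 0) g) x + (x \<bullet> h) / (\<rho> x * c) * ev (?t g) x)"
      by (auto simp: E_def ev_def)
    moreover have "\<rho> x \<noteq> 0" for x using \<rho>(1)[of x] by simp
    ultimately show ?thesis
      using c by (auto intro!: continuous_intros cont cont\<rho> smooth_dderiv that)
  qed
  have "has_bochner_integral lborel (\<lambda>x. F' b x b) 0" for b
  proof (rule integral_dderiv_zero[where F = "F b" and F' = "F' b" and M = "M + norm y"])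
    have "\<rho> x \<noteq> 0" for x using \<rho>(1)[of x] by simp
    then show "continuous_on UNIV (\<lambda>x. F' b x b)"
      unfolding F'_def using c
      by (auto intro!: continuous_intros contE cont cont\<rho> sm f)
    show "F b x = 0" if "norm x > M + norm y" for x
    proof -
      have v: "dderiv v f p = 0" if "norm p > M" for v p
        by (rule dderiv_eq_0[OF supp that f])
      have "ev f x = 0" by (rule ev0[OF supp that])
      moreover have "ev (?t f) x = 0" by (rule ev0[OF v that])
      moreover have "ev (?d b f) x = 0" by (rule ev0[OF v that])
      ultimately show ?thesis by (simp add: F_def)
    qed
  qed (use dF in auto)
  then have "has_bochner_integral lborel (\<lambda>x. \<Sum>b\<in>Basis. F' b x b) (\<Sum>b\<in>(Basis::(real^3) set). 0)"
    by (intro has_bochner_integral_sum)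
  moreover have "(\<Sum>b\<in>Basis. F' b x b) = ev (dAlembert c f) x / \<rho> x
     - \<epsilon>\<^sup>2 * ev (?t (?t f)) x / (c\<^sup>2 * \<rho> x^3)
     + 3 * \<epsilon>\<^sup>2 * ev (?t f) x / (c * \<rho> x^4) - 3 * \<epsilon>\<^sup>2 * ev f x / \<rho> x^5" for x
  proof -
    define r where "r = \<rho> x"
    have r: "r > 0" using \<rho>(1) by (simp add: r_def)
    define A where "A = ev f x"
    define T where "T = ev (?t f) x"
    define S where "S = ev (?t (?t f)) x"
    have trm: "F' b x b = - ev (?d b (?d b f)) x / r + T / (c * r^2) - A / r^3
        + (x \<bullet> b)\<^sup>2 * (S / (c\<^sup>2 * r^3) - 3 * T / (c * r^4) + 3 * A / r^5)" if b: "b \<in> Basis" for b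
    proof -
      have "b \<bullet> b = 1" using b by (simp add: inner_Basis)
      moreover have "ev (?t (?d b f)) x = ev (?d b (?t f)) x"
        using dderiv_commute[OF f] by (simp add: ev_def)
      moreover have fold: "?d b (?d b f) (x + y, \<rho> x / c) = ev (?d b (?d b f)) x"
        "?d b (?t f) (x + y, \<rho> x / c) = ev (?d b (?t f)) x" "?d b f (x + y, \<rho> x / c) = ev (?d b f) x"
        by (simp_all add: ev_def)
      ultimately show ?thesis
        using r c unfolding F'_def E_def fold r_def[symmetric] A_def[symmetric] T_def[symmetric] S_def[symmetric]
        by (simp add: field_simps power_numeral_reduce)
    qed
    have sq: "(\<Sum>b\<in>Basis. (x \<bullet> b)\<^sup>2) = r\<^sup>2 - \<epsilon>\<^sup>2"
      using \<rho>(2)[of x] euclidean_inner[of x x] dot_square_norm[of x] by (simp add: r_def power2_eq_square)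
    have "(\<Sum>b\<in>Basis. F' b x b) = - (\<Sum>b\<in>Basis. ev (?d b (?d b f)) x) / r + 3 * (T / (c * r^2) - A / r^3)
        + (r\<^sup>2 - \<epsilon>\<^sup>2) * (S / (c\<^sup>2 * r^3) - 3 * T / (c * r^4) + 3 * A / r^5)"
    proof -
      define U where "U = T / (c * r^2) - A / r^3"
      define V where "V = S / (c\<^sup>2 * r^3) - 3 * T / (c * r^4) + 3 * A / r^5"
      have "(\<Sum>b\<in>Basis. F' b x b) = (\<Sum>b\<in>Basis. - ev (?d b (?d b f)) x / r + U + (x \<bullet> b)\<^sup>2 * V)"
        by (rule sum.cong[OF refl]) (simp add: trm U_def V_def)
      also have "\<dots> = - (\<Sum>b\<in>Basis. ev (?d b (?d b f)) x) / r + 3 * U + (r\<^sup>2 - \<epsilon>\<^sup>2) * V"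
        unfolding sum.distrib sum_distrib_right[symmetric] sum_divide_distrib[symmetric] sum_negf sq by simp
      finally show ?thesis unfolding U_def V_def .
    qed
    also have "\<dots> = (S / c\<^sup>2 - (\<Sum>b\<in>Basis. ev (?d b (?d b f)) x)) / r - \<epsilon>\<^sup>2 * S / (c\<^sup>2 * r^3)
       + 3 * \<epsilon>\<^sup>2 * T / (c * r^4) - 3 * \<epsilon>\<^sup>2 * A / r^5"
      using r c by (simp add: field_simps power_numeral_reduce)
    also have "S / c\<^sup>2 - (\<Sum>b\<in>Basis. ev (?d b (?d b f)) x) = ev (dAlembert c f) x"
      by (simp add: S_def ev_def dAlembert_def)
    finally show ?thesis by (simp add: A_def T_def S_def r_def)
  qed
  ultimately show ?thesis by simp
qed

lemma retarded_potential:
  assumes \<phi>: "test_function f" and c: "c > 0"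
  shows "(\<integral>x. dAlembert c f (x, dist x y / c) / (4 * pi * dist x y) \<partial>lborel) = f (y, 0)"
proof -
  have f: "smooth f" using \<phi> by (simp add: test_function_def)
  have "bounded {p. f p \<noteq> 0}" using \<phi> unfolding test_function_def
    by (meson bounded_subset closure_subset compact_imp_bounded)
  then obtain M where M0: "\<forall>p\<in>{p. f p \<noteq> 0}. norm p \<le> M" unfolding bounded_iff by blast
  have supp: "f p = 0" if "norm p > M" for p proof (rule ccontr)
    assume "f p \<noteq> 0"
    then have "norm p \<le> M" using M0 by blast
    with that show False by simp
  qed
  let ?t = "dderiv (0, 1) :: _ \<Rightarrow> (real^3) \<times> real \<Rightarrow> real"
  let ?d = "\<lambda>b::real^3. dderiv (b, 0::real)"
  let ?A = "dAlembert c f"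
  have sm: "smooth (?t f)" "smooth (?t (?t f))" "smooth (?d b f)" "smooth (?d b (?d b f))" for b
    using f by (simp_all add: smooth_dderiv)
  have suppd: "dderiv v f p = 0" if "norm p > M" for v p
    by (rule dderiv_eq_0[OF supp that f])
  have suppdd: "dderiv w (dderiv v f) p = 0" if "norm p > M" for v w p
    by (rule dderiv_eq_0[OF suppd that smooth_dderiv[OF f]])
  have suppt: "?t f p = 0" "?d b f p = 0" "?t (?t f) p = 0" "?d b (?d b f) p = 0" if "norm p > M" for p b
    using suppd suppdd that by simp_all
  note supptt = suppt(3,4)
  have suppA: "?A p = 0" if "norm p > M" for p
    using supptt[OF that] by (simp add: dAlembert_def)
  have contA: "continuous_on UNIV ?A"
    unfolding dAlembert_def[abs_def] using c by (auto intro!: continuous_intros smooth_continuous[OF sm(2)] smooth_continuous[OF sm(4)])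
  obtain BT where BT: "BT \<ge> 0" "\<And>p. \<bar>?t f p\<bar> \<le> BT"
    using smooth_bounded[OF suppt(1) sm(1)] by blast
  obtain BS where BS: "BS \<ge> 0" "\<And>p. \<bar>?t (?t f) p\<bar> \<le> BS"
    using smooth_bounded[OF supptt(1) sm(2)] by blast
  have "\<exists>B. \<forall>b. B b \<ge> 0 \<and> (\<forall>p. \<bar>?d b f p\<bar> \<le> B b)"
    using smooth_bounded[OF suppt(2) sm(3)] by (intro choice allI) blast
  then obtain Bd where Bd: "\<And>b. Bd b \<ge> 0" "\<And>b p. \<bar>?d b f p\<bar> \<le> Bd b" by blast
  have "bounded (?A ` cball 0 M)"
    by (intro compact_imp_bounded compact_continuous_image continuous_on_subset[OF contA]) auto
  then obtain BA0 where BA0: "\<forall>p\<in>cball 0 M. \<bar>?A p\<bar> \<le> BA0" unfolding bounded_iff by auto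
  define BA where "BA = max BA0 0"
  have BA: "BA \<ge> 0" "\<bar>?A p\<bar> \<le> BA" for p
    using BA0 suppA[of p] unfolding BA_def by (cases "norm p > M"; auto simp: dist_norm le_max_iff_disj)+
  define N where "N = max (M + norm y) 0 + 1"
  have N: "N > 0" by (simp add: N_def)
  have suppN: "g (x + y, s) = 0" if "\<And>p. norm p > M \<Longrightarrow> g p = 0" "x \<notin> cball 0 N"
    for g :: "(real^3) \<times> real \<Rightarrow> real" and x s
  proof -
    have "norm x \<le> norm (x + y) + norm y" using norm_triangle_ineq4[of "x + y" y] by simp
    moreover have "norm (x + y) \<le> norm (x + y, s)" using norm_fst_le[of "x + y" s] by simp
    moreover have "norm x > N" using that(2) by (simp add: dist_norm)
    ultimately have "norm (x + y, s) > M" unfolding N_def by linarith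
    with that(1) show ?thesis by blast
  qed
  define e where "e = (\<lambda>n. 1 / real (Suc n))"
  have e: "e n > 0" "e n \<le> 1" for n by (auto simp: e_def)
  have el: "e \<longlonglongrightarrow> 0" unfolding e_def using LIMSEQ_inverse_real_of_nat by (simp add: field_simps)
  define \<rho> where "\<rho> = (\<lambda>n (x::real^3). sqrt ((norm x)\<^sup>2 + (e n)\<^sup>2))"
  have \<rho>: "\<rho> n x > 0" "\<rho> n x \<ge> e n" "\<rho> n x \<ge> norm x" for n x
    using e[of n] by (auto simp: \<rho>_def add_nonneg_pos real_le_rsqrt)
  define C where "C = (\<Sum>b\<in>(Basis::(real^3) set). Bd b) + BT / c"
  have C: "C \<ge> 0" unfolding C_def using Bd BT c by (auto intro!: add_nonneg_nonneg sum_nonneg)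
  have lip: "\<bar>f (x + y, \<rho> n x / c) - f (y, 0)\<bar> \<le> C * \<rho> n x" for n x
  proof -
    define v where "v = (x, \<rho> n x / c)"
    have "\<exists>s. 0 < s \<and> s < 1 \<and> f ((y, 0) + 1 *\<^sub>R v) - f ((y, 0) + 0 *\<^sub>R v) = (1 - 0) * dderiv v f ((y, 0) + s *\<^sub>R v)"
      by (rule MVT2) (use f in \<open>auto intro!: dderiv_line\<close>)
    then obtain s where "f (x + y, \<rho> n x / c) - f (y, 0) = dderiv v f ((y, 0) + s *\<^sub>R v)"
      by (auto simp: v_def add.commute)
    then have "\<bar>f (x + y, \<rho> n x / c) - f (y, 0)\<bar> = \<bar>(\<Sum>b\<in>Basis. (x \<bullet> b) * ?d b f ((y, 0) + s *\<^sub>R v)) + \<rho> n x / c * ?t f ((y, 0) + s *\<^sub>R v)\<bar>"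
      unfolding v_def by (subst (asm) dderiv_split_Basis[OF f]) simp
    also have "\<dots> \<le> (\<Sum>b\<in>Basis. \<bar>(x \<bullet> b) * ?d b f ((y, 0) + s *\<^sub>R v)\<bar>) + \<bar>\<rho> n x / c * ?t f ((y, 0) + s *\<^sub>R v)\<bar>"
      by (rule order_trans[OF abs_triangle_ineq add_right_mono[OF sum_abs]])
    also have "\<dots> \<le> (\<Sum>b\<in>(Basis::(real^3) set). \<rho> n x * Bd b) + \<rho> n x / c * BT"
    proof (intro add_mono sum_mono)
      fix b :: "real^3" assume "b \<in> Basis"
      then have "\<bar>x \<bullet> b\<bar> \<le> \<rho> n x" using Basis_le_norm[of b x] \<rho>(3)[of x n] by linarith
      then show "\<bar>(x \<bullet> b) * ?d b f ((y, 0) + s *\<^sub>R v)\<bar> \<le> \<rho> n x * Bd b"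
        unfolding abs_mult using Bd by (intro mult_mono) auto
    next
      show "\<bar>\<rho> n x / c * ?t f ((y, 0) + s *\<^sub>R v)\<bar> \<le> \<rho> n x / c * BT"
        unfolding abs_mult using BT \<rho>(1)[of n x] c by (intro mult_mono) auto
    qed
    also have "\<dots> = C * \<rho> n x" unfolding C_def sum_distrib_left[symmetric] by (simp add: algebra_simps)
    finally show ?thesis .
  qed
  define I where "I = (indicator (cball (0::real^3) N) :: real^3 \<Rightarrow> real)"
  define H where "H = (\<lambda>n x. ?A (x + y, \<rho> n x / c) / \<rho> n x
     - (e n)\<^sup>2 * ?t (?t f) (x + y, \<rho> n x / c) / (c\<^sup>2 * \<rho> n x^3)
     + 3 * (e n)\<^sup>2 * ?t f (x + y, \<rho> n x / c) / (c * \<rho> n x^4)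
     - 3 * (e n)\<^sup>2 * (f (x + y, \<rho> n x / c) - f (y, 0)) * I x / \<rho> n x^5)"
  define H0 where "H0 = (\<lambda>x. ?A (x + y, norm x / c) / norm x)"
  have Hint: "has_bochner_integral lborel (H n) (f (y, 0) * (4 * pi * N^3 / sqrt (N\<^sup>2 + (e n)\<^sup>2)^3))" for n
  proof -
    have "has_bochner_integral lborel (\<lambda>x. (?A (x + y, \<rho> n x / c) / \<rho> n x
     - (e n)\<^sup>2 * ?t (?t f) (x + y, \<rho> n x / c) / (c\<^sup>2 * \<rho> n x^3)
     + 3 * (e n)\<^sup>2 * ?t f (x + y, \<rho> n x / c) / (c * \<rho> n x^4) - 3 * (e n)\<^sup>2 * f (x + y, \<rho> n x / c) / \<rho> n x^5)
     + f (y, 0) * (I x * (3 * (e n)\<^sup>2 / \<rho> n x^5)))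
     (0 + f (y, 0) * (4 * pi * N^3 / sqrt (N\<^sup>2 + (e n)\<^sup>2)^3))"
      unfolding \<rho>_def I_def
      by (intro has_bochner_integral_add has_bochner_integral_mult_right
          wave_divergence_zero[OF f supp c e(1)] integral_kernel3[OF N e(1)])
    also have "(\<lambda>x. (?A (x + y, \<rho> n x / c) / \<rho> n x
     - (e n)\<^sup>2 * ?t (?t f) (x + y, \<rho> n x / c) / (c\<^sup>2 * \<rho> n x^3)
     + 3 * (e n)\<^sup>2 * ?t f (x + y, \<rho> n x / c) / (c * \<rho> n x^4) - 3 * (e n)\<^sup>2 * f (x + y, \<rho> n x / c) / \<rho> n x^5)
     + f (y, 0) * (I x * (3 * (e n)\<^sup>2 / \<rho> n x^5))) = H n"
    proof
      fix x
      show "(?A (x + y, \<rho> n x / c) / \<rho> n x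
     - (e n)\<^sup>2 * ?t (?t f) (x + y, \<rho> n x / c) / (c\<^sup>2 * \<rho> n x^3)
     + 3 * (e n)\<^sup>2 * ?t f (x + y, \<rho> n x / c) / (c * \<rho> n x^4) - 3 * (e n)\<^sup>2 * f (x + y, \<rho> n x / c) / \<rho> n x^5)
     + f (y, 0) * (I x * (3 * (e n)\<^sup>2 / \<rho> n x^5)) = H n x"
      proof (cases "x \<in> cball 0 N")
        case True
        then have "I x = 1" by (simp add: I_def)
        then show ?thesis by (simp add: H_def algebra_simps diff_divide_distrib)
      next
        case False
        then have "I x = 0" "f (x + y, \<rho> n x / c) = 0" using suppN[OF supp] by (auto simp: I_def)
        then show ?thesis by (simp add: H_def)
      qed
    qed
    finally show ?thesis by simp
  qed
  define K where "K = BA * N + BS * N / c\<^sup>2 + 3 * BT / c + 3 * C"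
  have lim: "(\<lambda>n. \<integral>x. H n x \<partial>lborel) \<longlonglongrightarrow> (\<integral>x. H0 x \<partial>lborel)"
  proof (rule integral_dominated_convergence[where w = "\<lambda>x. K * (indicator (cball 0 N) x / (norm x)\<^sup>2)"])
    show "integrable lborel (\<lambda>x::real^3. K * (indicator (cball 0 N) x / (norm x)\<^sup>2))"
      by (intro integrable_mult_right integrable_inverse_square3)
    have "continuous_on UNIV (\<lambda>x. ?A (x + y, norm x / c))"
      by (rule continuous_on_compose2[OF contA]) (use c in \<open>auto intro!: continuous_intros\<close>)
    then have "(\<lambda>x. ?A (x + y, norm x / c)) \<in> borel_measurable borel" by (rule borel_measurable_continuous_onI)
    then show "H0 \<in> borel_measurable lborel" unfolding H0_def by measurable
    show "H n \<in> borel_measurable lborel" for n by (rule borel_measurable_integrable[OF integrable.intros[OF Hint]])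
    show "AE x in lborel. (\<lambda>n. H n x) \<longlonglongrightarrow> H0 x"
    proof (rule AE_mp[OF AE_lborel_singleton[of 0]], rule AE_I2, rule impI)
      fix x :: "real^3" assume x: "x \<noteq> 0"
      have r: "(\<lambda>n. \<rho> n x) \<longlonglongrightarrow> norm x"
      proof -
        have "(\<lambda>n. \<rho> n x) \<longlonglongrightarrow> sqrt ((norm x)\<^sup>2 + 0\<^sup>2)" unfolding \<rho>_def by (intro tendsto_intros el)
        then show ?thesis by simp
      qed
      have q: "(\<lambda>n. (x + y, \<rho> n x / c)) \<longlonglongrightarrow> (x + y, norm x / c)"
        using c by (intro tendsto_intros r) auto
      have ct: "(\<lambda>n. g (x + y, \<rho> n x / c)) \<longlonglongrightarrow> g (x + y, norm x / c)"
        if "continuous_on UNIV g" for g :: "(real^3) \<times> real \<Rightarrow> real"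
        by (rule continuous_on_tendsto_compose[OF that q]) auto
      have "(\<lambda>n. H n x) \<longlonglongrightarrow> ?A (x + y, norm x / c) / norm x
        - 0\<^sup>2 * ?t (?t f) (x + y, norm x / c) / (c\<^sup>2 * norm x^3)
        + 3 * 0\<^sup>2 * ?t f (x + y, norm x / c) / (c * norm x^4)
        - 3 * 0\<^sup>2 * (f (x + y, norm x / c) - f (y, 0)) * I x / norm x^5"
        unfolding H_def using x c
        by (intro tendsto_intros r el ct contA smooth_continuous sm f) auto
      then show "(\<lambda>n. H n x) \<longlonglongrightarrow> H0 x" by (simp add: H0_def)
    qed
    show "AE x in lborel. norm (H n x) \<le> K * (indicator (cball 0 N) x / (norm x)\<^sup>2)" for n
    proof (rule AE_mp[OF AE_lborel_singleton[of 0]], rule AE_I2, rule impI)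
      fix x :: "real^3" assume x: "x \<noteq> 0"
      show "norm (H n x) \<le> K * (indicator (cball 0 N) x / (norm x)\<^sup>2)"
      proof (cases "x \<in> cball 0 N")
        case False
        have "?A (x + y, \<rho> n x / c) = 0" by (rule suppN[OF suppA False])
        moreover have "?t (?t f) (x + y, \<rho> n x / c) = 0" by (rule suppN[OF suppt(3) False])
        moreover have "?t f (x + y, \<rho> n x / c) = 0" by (rule suppN[OF suppt(1) False])
        moreover have "I x = 0" using False by (simp add: I_def)
        ultimately show ?thesis using False by (simp add: H_def)
      next
        case True
        define r where "r = norm x"
        define q where "q = \<rho> n x"
        define \<epsilon> where "\<epsilon> = e n"
        have r: "0 < r" "r \<le> N" "r \<le> q" using x True \<rho>(3)[of x n] by (auto simp: r_def q_def dist_norm)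
        have q: "q > 0" "0 < \<epsilon>" "\<epsilon> \<le> q" using \<rho>(1)[of n x] \<rho>(2)[of n x] e[of n] by (auto simp: q_def \<epsilon>_def)
        have q1: "1 / q \<le> N / r\<^sup>2"
        proof -
          have "r * r \<le> N * q" using r by (intro mult_mono) auto
          then show ?thesis using r q by (simp add: field_simps power2_eq_square)
        qed
        have q2: "1 / q\<^sup>2 \<le> 1 / r\<^sup>2" using r q by (simp add: frac_le power_mono)
        have e2: "\<epsilon>\<^sup>2 / q\<^sup>2 \<le> 1" using q by (simp add: power_mono)
        have b1: "\<bar>?A (x + y, q / c) / q\<bar> \<le> BA * (N / r\<^sup>2)"
        proof -
          have "\<bar>?A (x + y, q / c) / q\<bar> = \<bar>?A (x + y, q / c)\<bar> * (1 / q)" using q by (simp add: abs_divide)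
          also have "\<dots> \<le> BA * (N / r\<^sup>2)" using BA q1 q by (intro mult_mono) auto
          finally show ?thesis .
        qed
        have b2: "\<bar>\<epsilon>\<^sup>2 * ?t (?t f) (x + y, q / c) / (c\<^sup>2 * q^3)\<bar> \<le> BS / c\<^sup>2 * (N / r\<^sup>2)"
        proof -
          have "\<bar>\<epsilon>\<^sup>2 * ?t (?t f) (x + y, q / c) / (c\<^sup>2 * q^3)\<bar> = (\<bar>?t (?t f) (x + y, q / c)\<bar> / c\<^sup>2) * (1 / q) * (\<epsilon>\<^sup>2 / q\<^sup>2)"
            using q c by (simp add: abs_mult abs_divide power_numeral_reduce mult_ac)
          also have "\<dots> \<le> BS / c\<^sup>2 * (N / r\<^sup>2) * 1"
            using BS q1 q e2 N r by (intro mult_mono divide_right_mono) auto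
          finally show ?thesis by simp
        qed
        have b3: "\<bar>3 * \<epsilon>\<^sup>2 * ?t f (x + y, q / c) / (c * q^4)\<bar> \<le> 3 * BT / c * (1 / r\<^sup>2)"
        proof -
          have "\<bar>3 * \<epsilon>\<^sup>2 * ?t f (x + y, q / c) / (c * q^4)\<bar> = (3 * \<bar>?t f (x + y, q / c)\<bar> / c) * (1 / q\<^sup>2) * (\<epsilon>\<^sup>2 / q\<^sup>2)"
            using q c by (simp add: abs_mult abs_divide power_numeral_reduce mult_ac)
          also have "\<dots> \<le> 3 * BT / c * (1 / r\<^sup>2) * 1"
            using BT q2 q e2 c by (intro mult_mono divide_right_mono) auto
          finally show ?thesis by simp
        qed
        have b4: "\<bar>3 * \<epsilon>\<^sup>2 * (f (x + y, q / c) - f (y, 0)) * I x / q^5\<bar> \<le> 3 * C * (1 / r\<^sup>2)"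
        proof -
          have "I x = 1" using True by (simp add: I_def)
          moreover have "\<bar>3 * \<epsilon>\<^sup>2 * d * 1 / q^5\<bar> = 3 * (\<bar>d\<bar> / q) * (1 / q\<^sup>2) * (\<epsilon>\<^sup>2 / q\<^sup>2)" for d
            using q by (simp add: abs_mult abs_divide power_numeral_reduce mult_ac)
          ultimately have "\<bar>3 * \<epsilon>\<^sup>2 * (f (x + y, q / c) - f (y, 0)) * I x / q^5\<bar> = 3 * (\<bar>f (x + y, q / c) - f (y, 0)\<bar> / q) * (1 / q\<^sup>2) * (\<epsilon>\<^sup>2 / q\<^sup>2)"
            by (simp only:)
          also have "\<dots> \<le> 3 * C * (1 / r\<^sup>2) * 1"
          proof -
            have "\<bar>f (x + y, q / c) - f (y, 0)\<bar> / q \<le> C" using lip[of x n] q by (simp add: q_def field_simps)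
            then show ?thesis using q2 q e2 C by (intro mult_mono) auto
          qed
          finally show ?thesis by simp
        qed
        have "norm (H n x) \<le> \<bar>?A (x + y, q / c) / q\<bar> + \<bar>\<epsilon>\<^sup>2 * ?t (?t f) (x + y, q / c) / (c\<^sup>2 * q^3)\<bar>
            + \<bar>3 * \<epsilon>\<^sup>2 * ?t f (x + y, q / c) / (c * q^4)\<bar> + \<bar>3 * \<epsilon>\<^sup>2 * (f (x + y, q / c) - f (y, 0)) * I x / q^5\<bar>"
          unfolding H_def q_def[symmetric] \<epsilon>_def[symmetric] real_norm_def by linarith
        also have "\<dots> \<le> BA * (N / r\<^sup>2) + BS / c\<^sup>2 * (N / r\<^sup>2) + 3 * BT / c * (1 / r\<^sup>2) + 3 * C * (1 / r\<^sup>2)"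
          using b1 b2 b3 b4 by linarith
        also have "\<dots> = K * (1 / r\<^sup>2)" by (simp add: K_def add_divide_distrib distrib_right)
        also have "\<dots> = K * (indicator (cball 0 N) x / (norm x)\<^sup>2)" using True by (simp add: r_def)
        finally show ?thesis .
      qed
    qed
  qed
  have "(\<lambda>n. f (y, 0) * (4 * pi * N^3 / sqrt (N\<^sup>2 + (e n)\<^sup>2)^3)) \<longlonglongrightarrow> f (y, 0) * (4 * pi * N^3 / sqrt (N\<^sup>2 + 0\<^sup>2)^3)"
    using N by (intro tendsto_intros el) auto
  moreover have "(\<integral>x. H n x \<partial>lborel) = f (y, 0) * (4 * pi * N^3 / sqrt (N\<^sup>2 + (e n)\<^sup>2)^3)" for n
    using Hint by (rule has_bochner_integral_integral_eq)
  ultimately have H0: "(\<integral>x. H0 x \<partial>lborel) = 4 * pi * f (y, 0)"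
    using lim N LIMSEQ_unique by fastforce
  have "(\<integral>x. ?A (x, dist x y / c) / (4 * pi * dist x y) \<partial>lborel)
      = (\<integral>x. ?A (x, dist x y / c) / (4 * pi * dist x y) \<partial>distr lborel borel ((+) y))"
    by (simp add: lborel_distr_plus)
  also have "\<dots> = (\<integral>x. H0 x / (4 * pi) \<partial>lborel)"
  proof (subst integral_distr)
    have "continuous_on UNIV (\<lambda>x. ?A (x, dist x y / c))"
      by (rule continuous_on_compose2[OF contA]) (use c in \<open>auto intro!: continuous_intros\<close>)
    then have [measurable]: "(\<lambda>x. ?A (x, dist x y / c)) \<in> borel_measurable borel" by (rule borel_measurable_continuous_onI)
    show "(\<lambda>x. ?A (x, dist x y / c) / (4 * pi * dist x y)) \<in> borel_measurable borel" by measurable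
  qed (auto simp: H0_def dist_norm add.commute mult.commute)
  also have "\<dots> = f (y, 0)" using H0 by simp
  finally show ?thesis .
qed

theorem retarded_field_causal_wave_solution:
  assumes "c > 0"
  shows "causal_wave_solution c delta_pulse \<gamma> \<tau> (retarded_field c delta_pulse \<tau>)"
proof -
  have u: "(\<integral>x. pulse_apply (retarded_field c delta_pulse \<tau> x y) (\<lambda>t. g (x, t)) \<partial>lborel)
      = \<tau> y * (\<integral>x. g (x, dist x y / c) / (4 * pi * dist x y) \<partial>lborel)" for g y
    by (subst integral_mult_right_zero[symmetric])
      (simp add: pulse_apply_def retarded_field_def pulse_scale_def pulse_conv_def green_def)
  have "f (x, dist x y / c) = 0" if "closure {p. f p \<noteq> 0} \<subseteq> UNIV \<times> {..<0}" for f :: "(real^3) \<times> real \<Rightarrow> real" and x y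
  proof (rule ccontr)
    assume "f (x, dist x y / c) \<noteq> 0"
    then have "(x, dist x y / c) \<in> closure {p. f p \<noteq> 0}" by (simp add: closure_subset[THEN subsetD])
    with that have "dist x y / c < 0" by auto
    with assms show False by (simp add: divide_less_0_iff)
  qed
  note 0 = this
  show ?thesis
    unfolding causal_wave_solution_def field_distribution_def u
  proof (intro conjI allI impI)
    fix f :: "(real^3) \<times> real \<Rightarrow> real" assume "test_function f"
    then show "arc_integral \<gamma> (\<lambda>y. \<tau> y * (\<integral>x. dAlembert c f (x, dist x y / c) / (4 * pi * dist x y) \<partial>lborel))
        = arc_integral \<gamma> (\<lambda>y. \<tau> y * pulse_apply delta_pulse (\<lambda>t. f (y, t)))"
      using retarded_potential[OF _ assms] by (simp add: pulse_apply_def)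
  next
    fix f :: "(real^3) \<times> real \<Rightarrow> real"
    assume "test_function f \<and> closure {p. f p \<noteq> 0} \<subseteq> UNIV \<times> {..<0}"
    then have "f (x, dist x y / c) = 0" for x y using 0 by blast
    then show "arc_integral \<gamma> (\<lambda>y. \<tau> y * (\<integral>x. f (x, dist x y / c) / (4 * pi * dist x y) \<partial>lborel)) = 0"
      by (simp add: arc_integral_def)
  qed
qed

end

theory Submission
  imports Defs
begin

text \<open>
  For \<open>y \<noteq> z\<close> in the open disc, the zeros of \<open>|x - y| - |x - z|\<close> on the circle are its two
  intersections with the perpendicular bisector of \<open>y\<close> and \<open>z\<close>. There both distances have a common
  value \<open>r\<close>, and the tangential derivative of the travel time difference is \<open>\<plusminus> \<beta> / (c r)\<close> with
  \<open>\<beta>\<^sup>2 = |y - z|\<^sup>2 - k\<^sup>2\<close>, where \<open>|k| \<le> |y - z| (R + |z - a|) / (2 R)\<close>. Hence the inner integral is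
  comparable to \<open>1 / |y - z|\<close>, uniformly in \<open>y\<close>. For \<open>z\<close> off the curve this is bounded; for \<open>z\<close> on the
  curve, \<open>ds / |y - z|\<close> dominates the variation of \<open>ln |y - z|\<close>, which is infinite near \<open>z\<close>.
\<close>

section \<open>Orthonormal coordinates in the plane and trigonometric equations on the
  circle\<close>

text \<open>The span of \<open>e1\<close> and \<open>e2\<close> has dimension 2 by orthogonality and
  lies in the direction space of \<open>P\<close>, which also has dimension 2, so the two agree.
  This reduces the geometry to real coordinates.\<close>

lemma affine_plane_frame:
  fixes P :: "'a::euclidean_space set"
  assumes "affine P" "aff_dim P = 2" "a \<in> P" "a + e1 \<in> P" "a + e2 \<in> P"
    and e: "norm e1 = 1" "norm e2 = 1" "e1 \<bullet> e2 = 0"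
    and x: "x \<in> P"
  obtains k1 k2 where "x = a + k1 *\<^sub>R e1 + k2 *\<^sub>R e2"
proof -
  let ?V = "(+) (- a) ` P"
  have V: "subspace ?V" using assms by (intro affine_diffs_subspace)
  have "dim ?V = 2" using aff_dim_eq_dim[of a P] assms by (simp add: hull_inc)
  have "e1 \<noteq> e2" using e by (auto simp: dot_square_norm)
  have "e1 \<in> ?V" "e2 \<in> ?V"
    using assms(4,5) by (force intro: rev_image_eqI)+
  then have "span {e1, e2} \<subseteq> ?V" using V by (simp add: span_minimal)
  moreover have "independent {e1, e2}"
  proof (rule pairwise_orthogonal_independent)
    show "pairwise orthogonal {e1, e2}"
      using e by (auto simp: pairwise_def orthogonal_def inner_commute)
  qed (use e in auto)
  then have "dim (span {e1, e2}) = 2"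
    using \<open>e1 \<noteq> e2\<close> by (simp add: dim_eq_card_independent)
  ultimately have "span {e1, e2} = ?V"
    using V \<open>dim ?V = 2\<close> by (intro subspace_dim_equal) auto
  then have "x - a \<in> span {e1, e2}" using x by (auto simp: image_iff)
  then obtain k1 k2 where "x - a - k1 *\<^sub>R e1 = k2 *\<^sub>R e2"
    by (auto simp: span_insert span_singleton)
  then have "x = a + k1 *\<^sub>R e1 + k2 *\<^sub>R e2" by (simp add: algebra_simps)
  then show thesis by (rule that)
qed

lemma cos_sin_inject_2pi:
  assumes "cos x = cos y" "sin x = sin y" "0 \<le> x" "x < 2 * pi" "0 \<le> y" "y < 2 * pi"
  shows "x = y"
proof -
  obtain n :: int where n: "x = y + 2 * pi * n" using assms(1,2) sin_cos_eq_iff by metis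
  have "\<bar>2 * pi * real_of_int n\<bar> < 2 * pi" using n assms(3-) by linarith
  then have "n = 0" by (simp add: abs_mult)
  then show ?thesis using n by simp
qed

text \<open>The squares of \<open>w1 * cos + w2 * sin\<close> and of its derivative in the angle add
  up to the constant \<open>w1^2 + w2^2\<close>, so on a level set the derivative is fixed up to
  sign, and it is nonzero by \<open>k\<close>. The sign determines the point, whence at most two
  solutions. Later, \<open>Z \<noteq> {}\<close> serves the lower bound of the delta integral,
  \<open>card Z \<le> 2\<close> the upper one, and finiteness keeps the sum over \<open>Z\<close>
  from taking its default value 0.\<close>

lemma trig_level_set:
  fixes w1 w2 k R :: real
  assumes k: "k\<^sup>2 < w1\<^sup>2 + w2\<^sup>2" and R: "R > 0"
  defines "Z \<equiv> {s. 0 \<le> s \<and> s < 2 * pi * R \<and> w1 * cos (s / R) + w2 * sin (s / R) = k}"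
  shows "s \<in> Z \<Longrightarrow> \<bar>w2 * cos (s / R) - w1 * sin (s / R)\<bar> = sqrt (w1\<^sup>2 + w2\<^sup>2 - k\<^sup>2)"
    and "finite Z" "Z \<noteq> {}" "card Z \<le> 2"
proof -
  define W where "W = w1\<^sup>2 + w2\<^sup>2"
  define b where "b = sqrt (W - k\<^sup>2)"
  define B where "B s = w2 * cos (s / R) - w1 * sin (s / R)" for s
  have W: "W > 0" using k by (smt (verit) W_def zero_le_power2)
  have b2: "b\<^sup>2 = W - k\<^sup>2" using k by (simp add: b_def W_def)
  have B: "\<bar>B s\<bar> = b" if "s \<in> Z" for s
  proof -
    have "(w1 * cos (s / R) + w2 * sin (s / R))\<^sup>2 + (B s)\<^sup>2 = W * ((cos (s / R))\<^sup>2 + (sin (s / R))\<^sup>2)"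
      unfolding B_def W_def by algebra
    then have "(B s)\<^sup>2 = W - k\<^sup>2" using that by (simp add: Z_def)
    then show ?thesis unfolding b_def by (metis real_sqrt_abs)
  qed
  show "\<bar>w2 * cos (s / R) - w1 * sin (s / R)\<bar> = sqrt (w1\<^sup>2 + w2\<^sup>2 - k\<^sup>2)" if "s \<in> Z"
    using B[OF that] by (simp add: B_def b_def W_def)
  \<comment> \<open>The formulas for \<open>k\<close> and \<open>B s\<close> are linear in cosine
    and sine with determinant \<open>- W\<close>, so \<open>B s\<close> alone determines the point
    of the circle.\<close>
  have solve: "cos (s / R) = (w1 * k + w2 * B s) / W" "sin (s / R) = (w2 * k - w1 * B s) / W"
    if "s \<in> Z" for s
  proof -
    have "k = w1 * cos (s / R) + w2 * sin (s / R)" using that by (simp add: Z_def)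
    then have "W * cos (s / R) = w1 * k + w2 * B s" "W * sin (s / R) = w2 * k - w1 * B s"
      unfolding B_def W_def by algebra+
    then show "cos (s / R) = (w1 * k + w2 * B s) / W" "sin (s / R) = (w2 * k - w1 * B s) / W"
      using W by (simp_all add: field_simps)
  qed
  have inj: "inj_on B Z"
  proof (rule inj_onI)
    fix s t assume st: "s \<in> Z" "t \<in> Z" "B s = B t"
    have "s / R = t / R"
      by (rule cos_sin_inject_2pi)
        (use solve[OF st(1)] solve[OF st(2)] st R in \<open>auto simp: Z_def field_simps\<close>)
    then show "s = t" using R by simp
  qed
  have img: "B ` Z \<subseteq> {b, - b}" using B by fastforce
  show "finite Z" using inj img by (meson finite.emptyI finite.insertI inj_on_finite)
  have "card Z \<le> card {b, - b}" using inj img by (intro card_inj_on_le) auto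
  also have "\<dots> \<le> 2" by (simp add: card_insert_if)
  finally show "card Z \<le> 2" .
  \<comment> \<open>Existence: the candidate given by \<open>solve\<close> with \<open>B s\<close>
    replaced by \<open>b\<close> lies on the unit circle, hence is the cosine and sine of some
    angle.\<close>
  have "((w1 * k + w2 * b) / W)\<^sup>2 + ((w2 * k - w1 * b) / W)\<^sup>2 = (w1\<^sup>2 + w2\<^sup>2) * (k\<^sup>2 + b\<^sup>2) / W\<^sup>2"
    by (simp add: power_divide add_divide_distrib[symmetric]) algebra
  also have "\<dots> = 1" using W b2 by (simp add: W_def[symmetric]) (simp add: power2_eq_square)
  finally obtain \<theta> where \<theta>: "0 \<le> \<theta>" "\<theta> < 2 * pi"
    "(w1 * k + w2 * b) / W = cos \<theta>" "(w2 * k - w1 * b) / W = sin \<theta>"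
    using sincos_total_2pi by metis
  have "w1 * cos \<theta> + w2 * sin \<theta> = (w1\<^sup>2 + w2\<^sup>2) * k / W"
    unfolding \<theta>(3,4)[symmetric] by (simp add: add_divide_distrib[symmetric]) algebra
  then have "\<theta> * R \<in> Z" using \<theta> R W by (auto simp: Z_def W_def)
  then show "Z \<noteq> {}" by auto
qed

section \<open>Derivative of a distance, and the delta integral over the circle\<close>

lemma deriv_dist_curve:
  fixes X :: "real \<Rightarrow> 'a::real_inner"
  assumes "(X has_vector_derivative X') (at t)" "X t \<noteq> y"
  shows "((\<lambda>t. dist (X t) y) has_real_derivative (X t - y) \<bullet> X' / dist (X t) y) (at t)"
proof -
  have "((\<lambda>t. X t - y) has_derivative (\<lambda>h. h *\<^sub>R X')) (at t)"
    using assms(1) unfolding has_vector_derivative_def by (auto intro!: derivative_eq_intros)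
  then show ?thesis
    unfolding dist_norm has_field_derivative_def
    by (rule has_derivative_eq_rhs[OF has_derivative_compose[OF _ has_derivative_norm]])
      (use assms(2) in \<open>auto simp: sgn_div_norm inner_commute divide_inverse_commute mult_ac\<close>)
qed

text \<open>Each zero contributes a multiple of \<open>1 / (r * \<beta>)\<close>, with
  \<open>r\<close> the common distance to \<open>y\<close> and \<open>z\<close>. Both
  \<open>r\<close> and \<open>\<beta> / dist y z\<close> lie between positive constants independent
  of \<open>y\<close>, and there are one or two zeros. The lower estimate keeps a single
  zero.\<close>

lemma circle_delta_integral_green:
  fixes a e1 e2 y z :: "real^3"
  assumes c: "c > 0" and R: "R > 0"
    and e: "norm e1 = 1" "norm e2 = 1" "e1 \<bullet> e2 = 0"
    and y: "y = a + y1 *\<^sub>R e1 + y2 *\<^sub>R e2" "dist a y < R"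
    and z: "z = a + z1 *\<^sub>R e1 + z2 *\<^sub>R e2" "dist a z < R"
    and "y \<noteq> z" "\<tau> y \<ge> 0"
  defines "I \<equiv> circle_delta_integral a R e1 e2
       (\<lambda>x. weight (retarded_field c delta_pulse \<tau> x y) * weight (pulse_conv (green c x z) delta_pulse))
       (\<lambda>x. instant (retarded_field c delta_pulse \<tau> x y) - instant (pulse_conv (green c x z) delta_pulse))"
    and "\<kappa> \<equiv> \<tau> y * c / (16 * pi\<^sup>2 * dist y z)"
  shows "I \<ge> \<kappa> / (2 * R)"
    and "I \<le> 2 * (\<kappa> / ((R - dist a z) * sqrt (1 - ((R + dist a z) / (2 * R))\<^sup>2)))"
proof -
  define X where "X = circle_arc a R e1 e2"
  define T where "T s = - sin (s / R) *\<^sub>R e1 + cos (s / R) *\<^sub>R e2" for s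
  define d where "d = dist y z"
  \<comment> \<open>On the circle, equating the squared distances to \<open>y\<close> and
    \<open>z\<close> cancels all quadratic terms in the point and leaves the linear equation with
    coefficients \<open>w1\<close>, \<open>w2\<close> and right-hand side \<open>k\<close>, the
    perpendicular bisector.\<close>
  define w1 w2 where "w1 = z1 - y1" and "w2 = z2 - y2"
  define k where "k = ((z1\<^sup>2 + z2\<^sup>2) - (y1\<^sup>2 + y2\<^sup>2)) / (2 * R)"
  define \<beta> where "\<beta> = sqrt (w1\<^sup>2 + w2\<^sup>2 - k\<^sup>2)"
  define Z where "Z = {s. 0 \<le> s \<and> s < 2 * pi * R \<and> w1 * cos (s / R) + w2 * sin (s / R) = k}"
  have ee: "e1 \<bullet> e1 = 1" "e2 \<bullet> e2 = 1" "e1 \<bullet> e2 = 0" "e2 \<bullet> e1 = 0"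
    using e by (auto simp: dot_square_norm inner_commute)
  have frame: "(norm (p *\<^sub>R e1 + q *\<^sub>R e2))\<^sup>2 = p\<^sup>2 + q\<^sup>2" for p q
    by (simp only: power2_norm_eq_inner) (simp add: inner_add ee power2_eq_square)
  have d: "d > 0" "d\<^sup>2 = w1\<^sup>2 + w2\<^sup>2"
  proof -
    show "d > 0" using \<open>y \<noteq> z\<close> by (simp add: d_def)
    have "z - y = w1 *\<^sub>R e1 + w2 *\<^sub>R e2" by (simp add: y z w1_def w2_def algebra_simps)
    then show "d\<^sup>2 = w1\<^sup>2 + w2\<^sup>2" using frame by (metis d_def dist_commute dist_norm)
  qed
  have ny: "(dist a y)\<^sup>2 = y1\<^sup>2 + y2\<^sup>2" and nz: "(dist a z)\<^sup>2 = z1\<^sup>2 + z2\<^sup>2"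
    using frame[of y1 y2] frame[of z1 z2] by (simp_all add: y z dist_norm norm_minus_commute algebra_simps)
  \<comment> \<open>As a difference of squares, \<open>k\<close> has the factor
    \<open>dist a z - dist a y\<close>, at most \<open>d\<close> by the triangle inequality, and the
    factor \<open>dist a z + dist a y\<close>, at most \<open>R + dist a z\<close>. Since
    \<open>z\<close> is strictly inside, the resulting ratio \<open>q\<close> is below 1, uniformly
    in \<open>y\<close>.\<close>
  have kd: "\<bar>k\<bar> \<le> d * ((R + dist a z) / (2 * R))"
  proof -
    have "\<bar>dist a z - dist a y\<bar> \<le> d"
      unfolding d_def by (metis abs_dist_diff_le dist_commute)
    then have "\<bar>(dist a z - dist a y) * (dist a z + dist a y)\<bar> \<le> d * (R + dist a z)"
      unfolding abs_mult using y(2) by (intro mult_mono) auto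
    moreover have "k = (dist a z - dist a y) * (dist a z + dist a y) / (2 * R)"
      unfolding k_def ny[symmetric] nz[symmetric] by (simp add: power2_eq_square algebra_simps)
    ultimately show ?thesis using R by (simp add: divide_right_mono)
  qed
  define q where "q = (R + dist a z) / (2 * R)"
  have q: "0 < q" "q < 1" using R z(2) by (auto simp: q_def field_simps add_pos_nonneg)
  have q2: "q\<^sup>2 < 1" using q by (simp add: power_less_one_iff)
  have k2: "k\<^sup>2 \<le> d\<^sup>2 * q\<^sup>2"
    using power_mono[OF kd, of 2] by (simp add: q_def[symmetric] power_mult_distrib)
  have kW: "k\<^sup>2 < w1\<^sup>2 + w2\<^sup>2"
  proof -
    have "d\<^sup>2 * q\<^sup>2 < d\<^sup>2 * 1" using d q2 by (intro mult_strict_left_mono zero_less_power) auto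
    then show ?thesis using k2 d(2) by linarith
  qed
  note level = trig_level_set[OF kW R, folded Z_def]
  have \<beta>: "\<beta> > 0" "\<beta> \<le> d" "d * sqrt (1 - q\<^sup>2) \<le> \<beta>"
  proof -
    show "\<beta> > 0" using kW by (simp add: \<beta>_def)
    show "\<beta> \<le> d" unfolding \<beta>_def d(2)[symmetric] using d(1) by (intro real_le_lsqrt) auto
    have "d * sqrt (1 - q\<^sup>2) = sqrt (d\<^sup>2 * (1 - q\<^sup>2))" using d(1) by (simp add: real_sqrt_mult)
    also have "\<dots> \<le> \<beta>" unfolding \<beta>_def d(2)[symmetric]
      using k2 by (simp add: algebra_simps)
    finally show "d * sqrt (1 - q\<^sup>2) \<le> \<beta>" .
  qed
  have Xa: "dist a (X s) = R" for s
  proof -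
    have "(norm (X s - a))\<^sup>2 = (R * cos (s / R))\<^sup>2 + (R * sin (s / R))\<^sup>2"
      unfolding frame[symmetric] by (simp add: X_def circle_arc_def algebra_simps)
    also have "\<dots> = R\<^sup>2 * ((cos (s / R))\<^sup>2 + (sin (s / R))\<^sup>2)" by algebra
    finally have "norm (X s - a) = R" using R by simp
    then show ?thesis by (simp add: dist_norm norm_minus_commute)
  qed
  have Xd: "(dist (X s) v)\<^sup>2 = R\<^sup>2 + v1\<^sup>2 + v2\<^sup>2 - 2 * R * (v1 * cos (s / R) + v2 * sin (s / R))"
    if "v = a + v1 *\<^sub>R e1 + v2 *\<^sub>R e2" for v v1 v2 s
  proof -
    have "(dist (X s) v)\<^sup>2 = (R * cos (s / R) - v1)\<^sup>2 + (R * sin (s / R) - v2)\<^sup>2"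
      unfolding frame[symmetric] by (simp add: X_def circle_arc_def dist_norm that algebra_simps)
    also have "\<dots> = R\<^sup>2 * ((cos (s / R))\<^sup>2 + (sin (s / R))\<^sup>2) + v1\<^sup>2 + v2\<^sup>2 - 2 * R * (v1 * cos (s / R) + v2 * sin (s / R))"
      by algebra
    finally show ?thesis by simp
  qed
  have zeros: "dist (X s) y = dist (X s) z \<longleftrightarrow> w1 * cos (s / R) + w2 * sin (s / R) = k" for s
  proof -
    have "dist (X s) y = dist (X s) z \<longleftrightarrow> (dist (X s) y)\<^sup>2 = (dist (X s) z)\<^sup>2"
      by (simp add: power2_eq_iff_nonneg)
    also have "\<dots> \<longleftrightarrow> 2 * R * (w1 * cos (s / R) + w2 * sin (s / R)) = 2 * R * k"
    proof -
      have k': "2 * R * k = (z1\<^sup>2 + z2\<^sup>2) - (y1\<^sup>2 + y2\<^sup>2)" using R by (simp add: k_def)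
      show ?thesis unfolding Xd[OF y(1)] Xd[OF z(1)] k' w1_def w2_def
        by (simp add: algebra_simps)
    qed
    finally show ?thesis using R by simp
  qed
  define h where "h s = weight (retarded_field c delta_pulse \<tau> (X s) y)
      * weight (pulse_conv (green c (X s) z) delta_pulse)
      / \<bar>deriv (\<lambda>s. instant (retarded_field c delta_pulse \<tau> (X s) y)
           - instant (pulse_conv (green c (X s) z) delta_pulse)) s\<bar>" for s
  have I: "I = (\<Sum>s\<in>Z. h s)"
    unfolding I_def circle_delta_integral_def X_def[symmetric]
    by (rule sum.cong) (use c in \<open>auto simp: h_def Z_def zeros[symmetric] retarded_field_def pulse_scale_def pulse_conv_def green_def\<close>)
  have r: "R - dist a z \<le> dist (X s) z" "dist (X s) z \<le> 2 * R" for s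
    using Xa[of s] z(2) dist_triangle[of a "X s" z] dist_triangle[of "X s" z a]
    by (simp_all add: dist_commute)
  have "h s = \<tau> y * c / (16 * pi\<^sup>2) / (dist (X s) z * \<beta>)" if s: "s \<in> Z" for s
  proof -
    define r where "r = dist (X s) z"
    have r0: "r > 0" unfolding r_def using r(1)[of s] z(2) by linarith
    have ry: "dist (X s) y = r" using s by (simp add: r_def zeros Z_def)
    have ne: "X s \<noteq> y" "X s \<noteq> z" using r0 ry r_def by auto
    have X': "(X has_vector_derivative T s) (at s)"
      unfolding X_def circle_arc_def T_def using R
      by (auto intro!: derivative_eq_intros)
    have "((\<lambda>s. dist (X s) y / c - dist (X s) z / c) has_real_derivative
        (X s - y) \<bullet> T s / r / c - (X s - z) \<bullet> T s / r / c) (at s)"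
      using deriv_dist_curve[OF X' ne(1)] deriv_dist_curve[OF X' ne(2)]
      unfolding ry r_def[symmetric] by (intro DERIV_diff DERIV_cdivide)
    \<comment> \<open>Because both distances equal \<open>r\<close> at a zero, the terms with
      \<open>X s\<close> cancel and only the tangential component of \<open>z - y\<close>
      remains.\<close>
    moreover have "(X s - y) \<bullet> T s / r / c - (X s - z) \<bullet> T s / r / c = (z - y) \<bullet> T s / (c * r)"
      by (simp add: inner_diff_left diff_divide_distrib mult.commute)
    moreover have "(z - y) \<bullet> T s = w2 * cos (s / R) - w1 * sin (s / R)"
      by (simp add: y z T_def w1_def w2_def inner_simps ee algebra_simps)
    ultimately have "deriv (\<lambda>s. dist (X s) y / c - dist (X s) z / c) s
        = (w2 * cos (s / R) - w1 * sin (s / R)) / (c * r)"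
      by (simp add: DERIV_imp_deriv)
    then have "\<bar>deriv (\<lambda>s. dist (X s) y / c - dist (X s) z / c) s\<bar> = \<beta> / (c * r)"
      using level(1)[OF s] c r0 by (simp add: \<beta>_def)
    \<comment> \<open>The derivative in the denominator contributes a factor \<open>r\<close>, which
      cancels one of the two spreading factors \<open>1 / r\<close>.\<close>
    then have "h s = \<tau> y * (1 / (4 * pi * r)) * (1 / (4 * pi * r)) / (\<beta> / (c * r))"
      by (simp add: h_def retarded_field_def pulse_scale_def pulse_conv_def green_def ry r_def)
    also have "\<dots> = \<tau> y * c / (16 * pi\<^sup>2) / (r * \<beta>)"
      using c r0 \<beta> by (simp add: field_simps power2_eq_square)
    finally show ?thesis by (simp add: r_def)
  qed
  note h = this
  define K where "K = \<tau> y * c / (16 * pi\<^sup>2)"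
  have K: "K \<ge> 0" "\<kappa> = K / d" using \<open>\<tau> y \<ge> 0\<close> c by (auto simp: K_def \<kappa>_def d_def)
  have lower: "\<kappa> / (2 * R) \<le> h s" if "s \<in> Z" for s
  proof -
    have "K / (2 * R * d) \<le> K / (dist (X s) z * \<beta>)"
      using r[of s] z(2) \<beta> R K by (intro divide_left_mono mult_mono mult_pos_pos) auto
    then show ?thesis using h[OF that] K by (simp add: K_def mult_ac)
  qed
  have upper: "h s \<le> \<kappa> / ((R - dist a z) * sqrt (1 - q\<^sup>2))" if "s \<in> Z" for s
  proof -
    have "0 < sqrt (1 - q\<^sup>2)" using q2 by simp
    then have "K / (dist (X s) z * \<beta>) \<le> K / ((R - dist a z) * (d * sqrt (1 - q\<^sup>2)))"
      using r[of s] z(2) \<beta> R K d by (intro divide_left_mono mult_mono mult_pos_pos) auto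
    then show ?thesis using h[OF that] K by (simp add: K_def mult_ac)
  qed
  obtain s0 where s0: "s0 \<in> Z" using level by auto
  have "0 \<le> \<kappa> / (2 * R)" using K d R by simp
  then have nn: "0 \<le> h s" if "s \<in> Z" for s using lower[OF that] by linarith
  have "\<kappa> / (2 * R) \<le> h s0" using lower s0 .
  also have "\<dots> \<le> I" unfolding I using s0 nn level by (intro member_le_sum) auto
  finally show "I \<ge> \<kappa> / (2 * R)" .
  let ?u = "\<kappa> / ((R - dist a z) * sqrt (1 - q\<^sup>2))"
  have "I \<le> of_nat (card Z) * ?u" unfolding I by (rule sum_bounded_above) (rule upper)
  \<comment> \<open>Replacing \<open>card Z\<close> by 2 requires \<open>?u\<close> to be
    nonnegative, which the zero \<open>s0\<close> provides through
    \<open>0 \<le> h s0 \<le> ?u\<close>.\<close>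
  also have "\<dots> \<le> 2 * ?u"
    using level(4) upper[OF s0] nn[OF s0] by (intro mult_right_mono) auto
  finally show "I \<le> 2 * (\<kappa> / ((R - dist a z) * sqrt (1 - ((R + dist a z) / (2 * R))\<^sup>2)))"
    by (simp add: q_def)
qed

section \<open>Divergent and finite integrals along the curve\<close>

text \<open>The logarithm \<open>F\<close> of the distance to \<open>z\<close> changes at rate at
  most \<open>g t / dist (\<gamma> t) z\<close>, so on any parameter interval avoiding
  \<open>z\<close> the integral of \<open>f\<close> is at least \<open>K\<close> times the change of
  \<open>F\<close>. Starting such intervals ever closer to a parameter of \<open>z\<close> makes
  this change arbitrarily large.\<close>

lemma arc_nn_integral_eq_top:
  assumes \<gamma>: "piecewise_smooth_curve \<gamma>" and z: "z \<in> path_image \<gamma>" and K: "K > 0"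
    and f: "\<And>y. y \<in> path_image \<gamma> \<Longrightarrow> y \<noteq> z \<Longrightarrow> ennreal (K / dist y z) \<le> f y"
  shows "arc_nn_integral \<gamma> f = \<infinity>"
proof -
  define g where "g t = norm (vector_derivative \<gamma> (at t))" for t
  define F where "F t = ln (dist (\<gamma> t) z)" for t
  obtain S where S: "finite S" "\<gamma> C1_differentiable_on ({0..1} - S)"
    "\<And>t. t \<in> {0..1} - S \<Longrightarrow> vector_derivative \<gamma> (at t) \<noteq> 0"
    using \<gamma> by (auto simp: piecewise_smooth_curve_def)
  have cont: "continuous_on {0..1} \<gamma>" and g: "g integrable_on {0..1}"
    using \<gamma> by (auto simp: piecewise_smooth_curve_def path_def g_def[abs_def])
  have \<gamma>': "(\<gamma> has_vector_derivative vector_derivative \<gamma> (at t)) (at t)" if "t \<in> {0..1} - S" for t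
    using S(2) that by (auto simp: C1_differentiable_on_eq vector_derivative_works)
  have bound: "ennreal (K * \<bar>F t - F s\<bar>) \<le> arc_nn_integral \<gamma> f"
    if st: "0 \<le> s" "s \<le> t" "t \<le> 1" and ne: "\<And>v. v \<in> {s..t} \<Longrightarrow> \<gamma> v \<noteq> z" for s t
  proof -
    let ?G = "\<lambda>v. K / dist (\<gamma> v) z * g v"
    have cst: "continuous_on {s..t} \<gamma>" using cont by (rule continuous_on_subset) (use st in auto)
    have cr: "continuous_on {s..t} (\<lambda>v. K / dist (\<gamma> v) z)"
      by (intro continuous_intros cst) (use ne in auto)
    have "g integrable_on {s..t}" using g by (rule integrable_on_subinterval) (use st in auto)
    then have "g absolutely_integrable_on {s..t}"
      by (rule nonnegative_absolutely_integrable_1) (simp add: g_def)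
    \<comment> \<open>The speed may be unbounded near break points; it is absolutely integrable, and
      the other factor is continuous, hence bounded, on \<open>{s..t}\<close>.\<close>
    then have G: "?G absolutely_integrable_on {s..t}"
      using cr by (intro absolutely_integrable_bounded_measurable_product_real
        continuous_imp_measurable_on_sets_lebesgue compact_imp_bounded compact_continuous_image) auto
    have "((\<lambda>v. K * ((\<gamma> v - z) \<bullet> vector_derivative \<gamma> (at v) / dist (\<gamma> v) z / dist (\<gamma> v) z))
        has_integral K * F t - K * F s) {s..t}"
    \<comment> \<open>This form of the fundamental theorem tolerates the finite set \<open>S\<close>
      of break points.\<close>
    proof (rule fundamental_theorem_of_calculus_interior_strong[OF S(1) st(2)])
      fix v assume v: "v \<in> {s<..<t} - S"
      then have "\<gamma> v \<noteq> z" "v \<in> {0..1} - S" using ne st by auto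
      then have "(F has_real_derivative (\<gamma> v - z) \<bullet> vector_derivative \<gamma> (at v) / dist (\<gamma> v) z / dist (\<gamma> v) z) (at v)"
        unfolding F_def
        using DERIV_chain2[OF DERIV_ln_divide deriv_dist_curve[OF \<gamma>']] by simp
      then show "((\<lambda>v. K * F v) has_vector_derivative
          K * ((\<gamma> v - z) \<bullet> vector_derivative \<gamma> (at v) / dist (\<gamma> v) z / dist (\<gamma> v) z)) (at v)"
        unfolding has_real_derivative_iff_has_vector_derivative[symmetric] by (rule DERIV_cmult)
    next
      show "continuous_on {s..t} (\<lambda>v. K * F v)"
        unfolding F_def by (intro continuous_intros cst) (use ne in auto)
    qed
    moreover have "norm (K * ((\<gamma> v - z) \<bullet> vector_derivative \<gamma> (at v) / dist (\<gamma> v) z / dist (\<gamma> v) z)) \<le> ?G v"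
      if "v \<in> {s..t}" for v
    proof -
      have "\<bar>(\<gamma> v - z) \<bullet> vector_derivative \<gamma> (at v)\<bar> \<le> dist (\<gamma> v) z * g v"
        unfolding dist_norm g_def by (rule Cauchy_Schwarz_ineq2)
      then show ?thesis using ne[OF that] K
        by (simp add: abs_mult divide_simps mult_ac)
    qed
    ultimately have "norm (K * F t - K * F s) \<le> integral {s..t} ?G"
      using G by (metis (no_types, lifting) Henstock_Kurzweil_Integration.integral_norm_bound_integral integral_unique
        has_integral_integrable set_lebesgue_integral_eq_integral(1))
    also have "norm (K * F t - K * F s) = K * \<bar>F t - F s\<bar>"
      using K by (simp add: abs_mult right_diff_distrib[symmetric])
    finally have "ennreal (K * \<bar>F t - F s\<bar>) \<le> ennreal (integral {s..t} ?G)"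
      by (rule ennreal_leI)
    also have "\<dots> = (\<integral>\<^sup>+v. ennreal (?G v) \<partial>lebesgue_on {s..t})"
    proof -
      have "integrable (lebesgue_on {s..t}) ?G" using G by (rule absolutely_integrable_imp_integrable) simp
      then show ?thesis using K
        by (simp add: nn_integral_eq_integral lebesgue_integral_eq_integral g_def)
    qed
    also have "\<dots> \<le> (\<integral>\<^sup>+v. f (\<gamma> v) * ennreal (g v) \<partial>lebesgue_on {0..1})"
    proof -
      have "ennreal (?G v) \<le> f (\<gamma> v) * ennreal (g v)" if "v \<in> {s..t}" for v
      proof -
        have "ennreal (?G v) = ennreal (K / dist (\<gamma> v) z) * ennreal (g v)"
          using K by (subst ennreal_mult[symmetric]) (auto simp: g_def)
        also have "\<dots> \<le> f (\<gamma> v) * ennreal (g v)"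
          using ne[OF that] that st by (intro mult_right_mono f) (auto simp: path_image_def)
        finally show ?thesis .
      qed
      then show ?thesis
        using st by (simp add: nn_integral_restrict_space)
          (intro nn_integral_mono, auto split: split_indicator)
    qed
    finally show ?thesis by (simp add: arc_nn_integral_def g_def)
  qed
  obtain t0 where t0: "t0 \<in> {0..1}" "\<gamma> t0 = z" using z by (auto simp: path_image_def)
  \<comment> \<open>A curve constantly equal to \<open>z\<close> would have zero derivative at a
    parameter outside \<open>S\<close>, against regularity.\<close>
  obtain t1 where t1: "t1 \<in> {0..1}" "\<gamma> t1 \<noteq> z"
  proof (rule ccontr)
    assume "\<not> thesis"
    then have const: "\<And>t. t \<in> {0..1} \<Longrightarrow> \<gamma> t = z" using that by blast
    have "infinite ({0<..<1::real} - S)" using S(1) by (simp add: Diff_infinite_finite)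
    then obtain t where t: "t \<in> {0<..<1} - S" using infinite_imp_nonempty by blast
    have "(\<gamma> has_vector_derivative 0) (at t)"
      by (rule has_vector_derivative_transform_within_open[where S="{0<..<1}" and f="\<lambda>_. z"])
        (use t const in auto)
    then have "vector_derivative \<gamma> (at t) = 0" by (rule vector_derivative_at)
    then show False using S(3)[of t] t by auto
  qed
  have seg: "closed_segment t0 t1 \<subseteq> {0..1}"
    using t0 t1 by (intro closed_segment_subset) auto
  \<comment> \<open>The curve may pass through \<open>z\<close> many times. The point
    \<open>u0\<close> of the closed set \<open>C\<close> nearest to \<open>t1\<close> is the only
    parameter of \<open>z\<close> between \<open>u0\<close> and \<open>t1\<close>.\<close>
  define C where "C = {v \<in> closed_segment t0 t1. \<gamma> v = z}"
  have "closed C"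
    unfolding C_def using continuous_on_subset[OF cont seg]
    by (intro continuous_closed_preimage_constant) auto
  moreover have "C \<noteq> {}" using t0 by (auto simp: C_def)
  ultimately obtain u0 where u0: "u0 \<in> C" "\<And>v. v \<in> C \<Longrightarrow> dist t1 u0 \<le> dist t1 v"
    using distance_attains_inf[of C t1] by blast
  have u01: "u0 \<in> {0..1}" "\<gamma> u0 = z" "u0 \<noteq> t1" using u0(1) seg t1 by (auto simp: C_def)
  have free: "\<gamma> v \<noteq> z" if "v \<in> closed_segment u0 t1" "v \<noteq> u0" for v
  proof
    assume "\<gamma> v = z"
    moreover have "closed_segment u0 t1 \<subseteq> closed_segment t0 t1"
      using u0(1) by (simp add: C_def subset_closed_segment)
    then have "v \<in> closed_segment t0 t1" using that(1) by blast
    ultimately have "dist t1 u0 \<le> dist t1 v" by (intro u0(2)) (simp add: C_def)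
    then show False using that by (auto simp: closed_segment_eq_real_ivl dist_real_def split: if_splits)
  qed
  have large: "ennreal M \<le> arc_nn_integral \<gamma> f" if M: "M > 0" for M
  proof -
    \<comment> \<open>Chosen so that a distance to \<open>z\<close> below \<open>\<epsilon>\<close>
      forces \<open>F\<close> below \<open>F t1 - M / K\<close>.\<close>
    define \<epsilon> where "\<epsilon> = exp (F t1 - M / K)"
    have "\<epsilon> > 0" by (simp add: \<epsilon>_def)
    then obtain \<delta> where \<delta>: "\<delta> > 0" "\<And>v. v \<in> {0..1} \<Longrightarrow> dist v u0 < \<delta> \<Longrightarrow> dist (\<gamma> v) z < \<epsilon>"
      using cont[unfolded continuous_on_iff, rule_format, OF u01(1), of \<epsilon>] unfolding u01(2) by blast
    \<comment> \<open>The bound 1/2 keeps \<open>v\<close> strictly between \<open>u0\<close> and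
      \<open>t1\<close>; since \<open>\<bar>t1 - u0\<bar> \<le> 1\<close>, the bound
      \<open>\<delta> / 2\<close> keeps \<open>v\<close> within \<open>\<delta>\<close> of
      \<open>u0\<close>.\<close>
    define \<eta> where "\<eta> = min (1/2) (\<delta> / 2)"
    define v where "v = u0 + \<eta> * (t1 - u0)"
    have \<eta>: "0 < \<eta>" "\<eta> < 1" "\<eta> < \<delta>" using \<delta> by (auto simp: \<eta>_def)
    have vseg: "v \<in> closed_segment u0 t1" "v \<noteq> u0"
      using \<eta> u01 by (auto simp: v_def in_segment algebra_simps intro!: exI[of _ \<eta>])
    have v01: "v \<in> {0..1}"
      using vseg u01 t1 by (auto simp: closed_segment_eq_real_ivl split: if_splits)
    have "\<bar>t1 - u0\<bar> \<le> 1" using u01 t1 by auto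
    then have "\<eta> * \<bar>t1 - u0\<bar> \<le> \<eta> * 1" using \<eta> by (intro mult_left_mono) auto
    moreover have "dist v u0 = \<eta> * \<bar>t1 - u0\<bar>" using \<eta> by (simp add: v_def dist_real_def abs_mult)
    ultimately have "dist v u0 < \<delta>" using \<eta> by linarith
    then have "dist (\<gamma> v) z < \<epsilon>" using \<delta> v01 by blast
    then have "F v < ln \<epsilon>" unfolding F_def
      using free[OF vseg] by (intro ln_less_cancel_iff[THEN iffD2] \<open>\<epsilon> > 0\<close>) auto
    then have "F v < F t1 - M / K" by (simp add: \<epsilon>_def)
    then have "M / K \<le> \<bar>F t1 - F v\<bar>" by linarith
    then have MK: "M \<le> K * \<bar>F t1 - F v\<bar>" using K by (simp add: field_simps)
    have sub: "\<gamma> x \<noteq> z" if "x \<in> closed_segment v t1" for x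
    proof (rule free)
      have "closed_segment v t1 \<subseteq> closed_segment u0 t1" using vseg(1) by (simp add: subset_closed_segment)
      then show "x \<in> closed_segment u0 t1" using that by blast
      show "x \<noteq> u0"
        using that vseg by (auto simp: closed_segment_eq_real_ivl split: if_splits)
    qed
    have "ennreal (K * \<bar>F t1 - F v\<bar>) \<le> arc_nn_integral \<gamma> f"
    proof (cases "v \<le> t1")
      case True
      with sub v01 t1 show ?thesis by (intro bound) (auto simp: closed_segment_eq_real_ivl)
    next
      case False
      have "ennreal (K * \<bar>F v - F t1\<bar>) \<le> arc_nn_integral \<gamma> f"
        using False sub v01 t1 by (intro bound) (auto simp: closed_segment_eq_real_ivl)
      then show ?thesis by (simp add: abs_minus_commute)
    qed
    with MK show ?thesis by (meson ennreal_leI order_trans)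
  qed
  show ?thesis
  proof (rule ccontr)
    assume "arc_nn_integral \<gamma> f \<noteq> \<infinity>"
    then obtain r where r: "arc_nn_integral \<gamma> f = ennreal r" "r \<ge> 0"
      by (metis ennreal_cases infinity_ennreal_def)
    then show False using large[of "r + 1"] by (simp add: ennreal_le_iff)
  qed
qed

text \<open>The integral is at most \<open>C\<close> times the length of the curve, and the length
  is finite because the speed is integrable.\<close>

lemma arc_nn_integral_less_top:
  assumes \<gamma>: "piecewise_smooth_curve \<gamma>" and f: "\<And>y. y \<in> path_image \<gamma> \<Longrightarrow> f y \<le> ennreal C"
  shows "arc_nn_integral \<gamma> f < \<infinity>"
proof -
  let ?g = "\<lambda>t. norm (vector_derivative \<gamma> (at t))"
  have "?g absolutely_integrable_on {0..1}"
    using \<gamma> by (intro nonnegative_absolutely_integrable_1) (auto simp: piecewise_smooth_curve_def)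
  then have g: "integrable (lebesgue_on {0..1}) ?g"
    by (rule absolutely_integrable_imp_integrable) simp
  have "arc_nn_integral \<gamma> f \<le> (\<integral>\<^sup>+t. ennreal C * ennreal (?g t) \<partial>lebesgue_on {0..1})"
    unfolding arc_nn_integral_def
    by (intro nn_integral_mono mult_right_mono f) (auto simp: path_image_def)
  also have "\<dots> = ennreal C * ennreal (integral\<^sup>L (lebesgue_on {0..1}) ?g)"
    using g by (simp add: nn_integral_cmult nn_integral_eq_integral)
  also have "\<dots> < \<infinity>" by (simp add: ennreal_mult_less_top)
  finally show ?thesis .
qed

section \<open>The indicator function on and off the source curve\<close>

theorem theorem3p5:
  fixes c R \<tau>\<^sub>0 :: real
    and P \<Omega> D L :: "(real^3) set"
    and a e1 e2 :: "real^3"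
    and \<gamma> :: "real \<Rightarrow> real^3"
    and \<tau> :: "real^3 \<Rightarrow> real"
    and l :: pulse
    and u :: field
  assumes c: "c > 0"
    and plane: "affine P" "aff_dim P = 2"
    and curve: "piecewise_smooth_curve \<gamma>" "L = path_image \<gamma>" "L \<subseteq> P"
    and intensity: "(\<lambda>t. \<tau> (\<gamma> t)) \<in> borel_measurable (lebesgue_on {0..1})"
      "bounded (\<tau> ` L)" "\<tau>\<^sub>0 > 0" "\<forall>x\<in>L. \<tau> x \<ge> \<tau>\<^sub>0"
    and signal: "l = delta_pulse"
    and wave: "causal_wave_solution c l \<gamma> \<tau> u" "u = retarded_field c l \<tau>"
    and disc: "a \<in> P" "R > 0" "\<Omega> = ball a R \<inter> P" "L \<subseteq> \<Omega>"
    and frame: "norm e1 = 1" "norm e2 = 1" "e1 \<bullet> e2 = 0" "a + e1 \<in> P" "a + e2 \<in> P"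
    and sampling: "D \<subseteq> \<Omega>" "L \<subseteq> D" "D \<inter> (sphere a R \<inter> P) = {}"
  shows "(\<forall>z\<in>L. indicator_function c l \<gamma> a R e1 e2 u z = \<infinity>) \<and>
         (\<forall>z\<in>D - L. indicator_function c l \<gamma> a R e1 e2 u z < \<infinity>)"
proof -
  define I where "I z y = circle_delta_integral a R e1 e2
       (\<lambda>x. weight (u x y) * weight (pulse_conv (green c x z) l))
       (\<lambda>x. instant (u x y) - instant (pulse_conv (green c x z) l))" for z y
  have ind: "indicator_function c l \<gamma> a R e1 e2 u z = arc_nn_integral \<gamma> (\<lambda>y. ennreal (I z y))" for z
    by (simp add: indicator_function_def I_def)
  have I: "\<tau> y * c / (16 * pi\<^sup>2 * dist y z) / (2 * R) \<le> I z y"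
    "I z y \<le> 2 * (\<tau> y * c / (16 * pi\<^sup>2 * dist y z) /
      ((R - dist a z) * sqrt (1 - ((R + dist a z) / (2 * R))\<^sup>2)))"
    if y: "y \<in> L" and z: "z \<in> D" and "y \<noteq> z" for y z
  proof -
    have yz: "y \<in> P" "z \<in> P" "dist a y < R" "dist a z < R" using y z disc sampling by auto
    obtain y1 y2 where y': "y = a + y1 *\<^sub>R e1 + y2 *\<^sub>R e2"
      using affine_plane_frame plane disc(1) frame yz(1) by metis
    obtain z1 z2 where z': "z = a + z1 *\<^sub>R e1 + z2 *\<^sub>R e2"
      using affine_plane_frame plane disc(1) frame yz(2) by metis
    have "\<tau> y \<ge> 0" using intensity(3,4) y by fastforce
    note circle_delta_integral_green[where \<tau> = \<tau>, OF c disc(2) frame(1-3) y' yz(3) z' yz(4) \<open>y \<noteq> z\<close> this]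
    then show "\<tau> y * c / (16 * pi\<^sup>2 * dist y z) / (2 * R) \<le> I z y"
      "I z y \<le> 2 * (\<tau> y * c / (16 * pi\<^sup>2 * dist y z) /
        ((R - dist a z) * sqrt (1 - ((R + dist a z) / (2 * R))\<^sup>2)))"
      by (simp_all add: I_def signal wave(2))
  qed
  show ?thesis
  proof (intro conjI ballI)
    fix z assume z: "z \<in> L"
    \<comment> \<open>The factor of \<open>1 / dist y z\<close> in the lower estimate, with
      \<open>\<tau> y\<close> replaced by its lower bound \<open>\<tau>\<^sub>0\<close> to make it
      independent of \<open>y\<close>.\<close>
    define K where "K = \<tau>\<^sub>0 * c / (16 * pi\<^sup>2) / (2 * R)"
    have "K > 0" using c disc(2) intensity(3) by (simp add: K_def)
    have "ennreal (K / dist y z) \<le> ennreal (I z y)" if y: "y \<in> L" "y \<noteq> z" for y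
    proof (rule ennreal_leI)
      have "K / dist y z = \<tau>\<^sub>0 * c / (16 * pi\<^sup>2 * dist y z) / (2 * R)"
        by (simp add: K_def mult_ac)
      also have "\<dots> \<le> \<tau> y * c / (16 * pi\<^sup>2 * dist y z) / (2 * R)"
        using intensity(4) y c disc(2) by (intro divide_right_mono mult_right_mono) auto
      also have "\<dots> \<le> I z y" using y z sampling(2) by (intro I) auto
      finally show "K / dist y z \<le> I z y" .
    qed
    then show "indicator_function c l \<gamma> a R e1 e2 u z = \<infinity>"
      unfolding ind using curve(1) z \<open>K > 0\<close> unfolding curve(2) by (intro arc_nn_integral_eq_top)
  next
    fix z assume z: "z \<in> D - L"
    have "dist a z < R" using z sampling(1) disc(3) by auto
    \<comment> \<open>As \<open>z\<close> lies strictly inside the disc, neither factor in the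
      denominator \<open>A\<close> of the upper estimate degenerates.\<close>
    then have az: "0 < R - dist a z" "((R + dist a z) / (2 * R))\<^sup>2 < 1"
      using disc(2) by (auto simp: abs_square_less_1)
    define A where "A = (R - dist a z) * sqrt (1 - ((R + dist a z) / (2 * R))\<^sup>2)"
    have A: "A > 0" using az by (simp add: A_def)
    have "compact L" using curve by (auto simp: piecewise_smooth_curve_def compact_path_image)
    \<comment> \<open>A point off the compact curve keeps a positive distance from it, which bounds
      \<open>1 / dist y z\<close> uniformly in \<open>y\<close>.\<close>
    then obtain \<delta> where \<delta>: "\<delta> > 0" "\<And>y. y \<in> L \<Longrightarrow> \<delta> \<le> dist z y"
      using separate_point_closed[of L z] z by (auto dest: compact_imp_closed)
    obtain T where T: "\<And>y. y \<in> L \<Longrightarrow> \<bar>\<tau> y\<bar> \<le> T"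
      using intensity(2) by (auto simp: bounded_iff)
    have "ennreal (I z y) \<le> ennreal (2 * (T * c / (16 * pi\<^sup>2 * \<delta>) / A))" if y: "y \<in> L" for y
    proof (rule ennreal_leI)
      have "I z y \<le> 2 * (\<tau> y * c / (16 * pi\<^sup>2 * dist y z) / A)"
        unfolding A_def using y z by (intro I) auto
      also have "\<dots> \<le> 2 * (T * c / (16 * pi\<^sup>2 * \<delta>) / A)"
      proof -
        have "\<tau> y * c \<le> T * c" "0 \<le> T * c" using T[OF y] c by auto
        moreover have "\<delta> \<le> dist y z" using \<delta>(2)[OF y] by (simp add: dist_commute)
        ultimately show ?thesis using \<delta>(1) A
          by (intro mult_left_mono divide_right_mono frac_le) auto
      qed
      finally show "I z y \<le> 2 * (T * c / (16 * pi\<^sup>2 * \<delta>) / A)" .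
    qed
    then show "indicator_function c l \<gamma> a R e1 e2 u z < \<infinity>"
      unfolding ind using curve(1) unfolding curve(2) by (intro arc_nn_integral_less_top)
  qed
qed

end
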